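(* Let $G$ be a finite simple graph with villainy $B(G)=2$. Then $G$ is (up to isomorphism) one of the following graphs: 1. $G=K_{1,t}$ for some $t\geq 2$; 2. $G$ is a 6-vertex connected bipartite graph with parts of size 3; 3. $G=P_4$ or $G=P_4+K_1$ or $G=P_4+K_2$; 4. $G=C_4$ or $G=C_4+K_1$ or $G=C_4+K_2$; 5. $G=C_5$; 6. $G=K_2+K_2$ or $G=K_2+K_2+K_2$; 7. $G=K_3+K_2$; 8. $G=K_3+K_3$; 9. $G=K_2+K_2+K_1$; 10. $n(G)\geq 4$ and $G$ has a vertex $v$ of degree 0 or 1 such that $G-v$ is a complete graph; 11. $G=P_3+rK_1$ for some $r\geq 1$; 12. $G=K_2+rK_1$ for some $r\geq 1$.
   Context: All graphs are finite and simple. $n(G)$ is the number of vertices of $G$; $K_n$, $C_n$, $P_n$ are the complete graph, cycle and path on $n$ vertices; $K_{m,n}$ is the complete bipartite graph with parts of sizes $m$ and $n$; $G+H$ is the disjoint union of $G$ and $H$, and $rK_1$ is the disjoint union of $r$ isolated vertices. A coloring of the vertices of $G$ is proper if adjacent vertices receive different colors; $\chi(G)$ is the chromatic number. Let $P(G)$ be the set of all vertex colorings $c$ of $G$ obtained from some proper coloring $f$ of $G$ with $\chi(G)$ colors by permuting the colors among the vertices, i.e. $c=f\circ\sigma$ for some bijection $\sigma:V(G)\to V(G)$ (so $c$ uses each color exactly as many times as $f$; $c$ need not be proper). For $c\in P(G)$, $B(c)$ is the minimum number of vertices that must be recolored in order to turn $c$ into a proper coloring of $G$ in which each color appears exactly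 as many times as it does in $c$; that is, the minimum over all such proper colorings $g$ of $|\{v\in V(G): g(v)\neq c(v)\}|$. The villainy of $G$ is $B(G)=\max\{B(c): c\in P(G)\}$. *)

theory Defs
  imports Main
begin

record 'a sgraph =
  verts :: "'a set"
  edges :: "'a set set"

definition simple_graph :: "'a sgraph \<Rightarrow> bool" where
  "simple_graph G \<longleftrightarrow> finite (verts G) \<and> (\<forall>e\<in>edges G. e \<subseteq> verts G \<and> card e = 2)"

definition graph_iso :: "'a sgraph \<Rightarrow> 'b sgraph \<Rightarrow> bool" (infix "\<simeq>" 50) where
  "G \<simeq> H \<longleftrightarrow> (\<exists>\<phi>. bij_betw \<phi> (verts G) (verts H) \<and>
     (\<forall>u\<in>verts G. \<forall>v\<in>verts G. {u, v} \<in> edges G \<longleftrightarrow> {\<phi> u, \<phi> v} \<in> edges H))"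

definition degree :: "'a sgraph \<Rightarrow> 'a \<Rightarrow> nat" where
  "degree G v = card {u \<in> verts G. {u, v} \<in> edges G}"

definition delete_vertex :: "'a sgraph \<Rightarrow> 'a \<Rightarrow> 'a sgraph" where
  "delete_vertex G v = \<lparr>verts = verts G - {v}, edges = {e \<in> edges G. v \<notin> e}\<rparr>"

definition is_complete :: "'a sgraph \<Rightarrow> bool" where
  "is_complete G \<longleftrightarrow> (\<forall>u\<in>verts G. \<forall>v\<in>verts G. u \<noteq> v \<longrightarrow> {u, v} \<in> edges G)"

definition connected_graph :: "'a sgraph \<Rightarrow> bool" where
  "connected_graph G \<longleftrightarrow> verts G \<noteq> {} \<and>
     (\<forall>u\<in>verts G. \<forall>v\<in>verts G. (u, v) \<in> {(x, y). {x, y} \<in> edges G}\<^sup>*)"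

definition bipartition :: "'a sgraph \<Rightarrow> 'a set \<Rightarrow> 'a set \<Rightarrow> bool" where
  "bipartition G X Y \<longleftrightarrow> X \<union> Y = verts G \<and> X \<inter> Y = {} \<and>
     (\<forall>e\<in>edges G. \<exists>x\<in>X. \<exists>y\<in>Y. e = {x, y})"

definition complete_graph :: "nat \<Rightarrow> nat sgraph" where
  "complete_graph n =
     \<lparr>verts = {..<n}, edges = {{i, j} | i j. i < n \<and> j < n \<and> i \<noteq> j}\<rparr>"

definition empty_graph :: "nat \<Rightarrow> nat sgraph" where
  "empty_graph r = \<lparr>verts = {..<r}, edges = {}\<rparr>"

definition path_graph :: "nat \<Rightarrow> nat sgraph" where
  "path_graph n = \<lparr>verts = {..<n}, edges = {{i, Suc i} | i. Suc i < n}\<rparr>"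

(* A cycle only for n \<ge> 3: n = 1 gives a loop and n = 2 a single edge. *)
definition cycle_graph :: "nat \<Rightarrow> nat sgraph" where
  "cycle_graph n = \<lparr>verts = {..<n}, edges = {{i, Suc i mod n} | i. i < n}\<rparr>"

definition complete_bipartite_graph :: "nat \<Rightarrow> nat \<Rightarrow> (nat + nat) sgraph" where
  "complete_bipartite_graph m n =
     \<lparr>verts = {..<m} <+> {..<n}, edges = {{Inl i, Inr j} | i j. i < m \<and> j < n}\<rparr>"

definition disjoint_union :: "'a sgraph \<Rightarrow> 'b sgraph \<Rightarrow> ('a + 'b) sgraph" (infixl "\<uplus>" 65) where
  "G \<uplus> H =
     \<lparr>verts = verts G <+> verts H, edges = (`) Inl ` edges G \<union> (`) Inr ` edges H\<rparr>"

definition proper_coloring :: "'a sgraph \<Rightarrow> ('a \<Rightarrow> nat) \<Rightarrow> bool" where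
  "proper_coloring G f \<longleftrightarrow>
     (\<forall>u\<in>verts G. \<forall>v\<in>verts G. {u, v} \<in> edges G \<longrightarrow> f u \<noteq> f v)"

(* Colors are the numbers below k; values of f outside the vertex set are irrelevant. *)
definition proper_k_coloring :: "'a sgraph \<Rightarrow> nat \<Rightarrow> ('a \<Rightarrow> nat) \<Rightarrow> bool" where
  "proper_k_coloring G k f \<longleftrightarrow> proper_coloring G f \<and> f ` verts G \<subseteq> {..<k}"

definition chromatic_number :: "'a sgraph \<Rightarrow> nat" where
  "chromatic_number G = (LEAST k. \<exists>f. proper_k_coloring G k f)"

definition permuted_colorings :: "'a sgraph \<Rightarrow> ('a \<Rightarrow> nat) set" where
  "permuted_colorings G =
     {f \<circ> \<sigma> | f \<sigma>. proper_k_coloring G (chromatic_number G) f \<and>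
        bij_betw \<sigma> (verts G) (verts G)}"

definition same_color_counts :: "'a sgraph \<Rightarrow> ('a \<Rightarrow> nat) \<Rightarrow> ('a \<Rightarrow> nat) \<Rightarrow> bool" where
  "same_color_counts G g c \<longleftrightarrow>
     (\<forall>i. card {v \<in> verts G. g v = i} = card {v \<in> verts G. c v = i})"

definition coloring_villainy :: "'a sgraph \<Rightarrow> ('a \<Rightarrow> nat) \<Rightarrow> nat" where
  "coloring_villainy G c =
     Min {card {v \<in> verts G. g v \<noteq> c v} | g. proper_coloring G g \<and> same_color_counts G g c}"

definition villainy :: "'a sgraph \<Rightarrow> nat" where
  "villainy G = Max (coloring_villainy G ` permuted_colorings G)"

text \<open>
  The sets whose minimum and maximum are taken above are finite and nonempty, so
  \<open>Min\<close> and \<open>Max\<close> have their usual meaning.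
\<close>

lemma recoloring_sizes_finite:
  assumes "simple_graph G"
  shows "finite {card {v \<in> verts G. g v \<noteq> c v} | g. proper_coloring G g \<and> same_color_counts G g c}"
proof (rule finite_subset)
  show "{card {v \<in> verts G. g v \<noteq> c v} | g. proper_coloring G g \<and> same_color_counts G g c}
      \<subseteq> {..card (verts G)}"
    using assms by (auto simp: simple_graph_def intro!: card_mono)
qed simp

lemma recoloring_sizes_nonempty:
  assumes "c \<in> permuted_colorings G"
  shows "{card {v \<in> verts G. g v \<noteq> c v} | g. proper_coloring G g \<and> same_color_counts G g c} \<noteq> {}"
proof -
  obtain f \<sigma> where f: "proper_coloring G f"
    and \<sigma>: "bij_betw \<sigma> (verts G) (verts G)" and c: "c = f \<circ> \<sigma>"
    using assms by (auto simp: permuted_colorings_def proper_k_coloring_def)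
  have "bij_betw \<sigma> {v \<in> verts G. c v = i} {v \<in> verts G. f v = i}" for i
    using \<sigma> unfolding c bij_betw_def by (auto simp: inj_on_def)
  then have "same_color_counts G f c"
    unfolding same_color_counts_def by (metis bij_betw_same_card)
  with f show ?thesis by blast
qed

lemma chromatic_number_coloring:
  assumes "simple_graph G"
  shows "\<exists>f. proper_k_coloring G (chromatic_number G) f"
proof -
  have "finite (verts G)"
    using assms by (simp add: simple_graph_def)
  then obtain f where f: "bij_betw f (verts G) {0..<card (verts G)}"
    using ex_bij_betw_finite_nat by blast
  have "f u \<noteq> f v" if "u \<in> verts G" "v \<in> verts G" "{u, v} \<in> edges G" for u v
  proof
    assume "f u = f v"
    then have "u = v"
      using f that(1,2) by (meson bij_betw_imp_inj_on inj_onD)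
    then have "card {u, v} = 1" by simp
    moreover have "card {u, v} = 2"
      using that(3) assms unfolding simple_graph_def by blast
    ultimately show False by simp
  qed
  moreover have "f ` verts G \<subseteq> {..<card (verts G)}"
    using f by (simp add: bij_betw_def lessThan_atLeast0)
  ultimately have "proper_k_coloring G (card (verts G)) f"
    by (simp add: proper_k_coloring_def proper_coloring_def)
  then have "\<exists>f. proper_k_coloring G (card (verts G)) f" by blast
  then show ?thesis
    unfolding chromatic_number_def by (rule LeastI)
qed

lemma permuted_colorings_nonempty:
  assumes "simple_graph G"
  shows "permuted_colorings G \<noteq> {}"
proof -
  obtain f where "proper_k_coloring G (chromatic_number G) f"
    using chromatic_number_coloring[OF assms] by blast
  then have "f \<circ> id \<in> permuted_colorings G"
    unfolding permuted_colorings_def using bij_betw_id by blast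
  then show ?thesis by blast
qed

lemma coloring_villainies_finite:
  assumes "simple_graph G"
  shows "finite (coloring_villainy G ` permuted_colorings G)"
proof (rule finite_subset)
  show "coloring_villainy G ` permuted_colorings G \<subseteq> {..card (verts G)}"
  proof (intro image_subsetI, unfold atMost_iff)
    fix c assume c: "c \<in> permuted_colorings G"
    have "coloring_villainy G c \<in>
        {card {v \<in> verts G. g v \<noteq> c v} | g. proper_coloring G g \<and> same_color_counts G g c}"
      unfolding coloring_villainy_def
      by (rule Min_in[OF recoloring_sizes_finite[OF assms] recoloring_sizes_nonempty[OF c]])
    then obtain g where "coloring_villainy G c = card {v \<in> verts G. g v \<noteq> c v}"
      by blast
    moreover have "card {v \<in> verts G. g v \<noteq> c v} \<le> card (verts G)"
      using assms by (intro card_mono) (auto simp: simple_graph_def)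
    ultimately show "coloring_villainy G c \<le> card (verts G)"
      by simp
  qed
qed simp

end

theory Submission
  imports Defs "HOL-Combinatorics.Transposition"
begin

text \<open>
  Villainy 2 means that every permuted optimal coloring can be made proper by a single
  transposition of two vertices. If \<open>x\<^sub>1, \<dots>, x\<^sub>m\<close> are given the colors that an optimal coloring
  assigns to \<open>y\<^sub>1, \<dots>, y\<^sub>m\<close>, the two transposed vertices must meet every monochromatic edge, and they
  have different colors. Hence a color class of size at least 4 forbids two disjoint edges and
  triangles (so the graph is a star with isolated vertices), a class of size 3 forbids triangles, three
  classes of size at least 2 forbid three disjoint edges, and a class of size at least 3 together with
  another one of size at least 2 forbids 5-cycles. For two colors the class sizes are then at most 3 and
  reversing components settles the rest. For at least three colors, a triangle-free graph has at most
  one singleton class and contains a 5-cycle or three disjoint edges; this excludes classes of size 3,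
  and if all classes have size at most 2, one distinguishes the number of classes of size 2.
\<close>

section \<open>Repairing a permuted coloring by one transposition\<close>

text \<open>Optimality is exploited through recoloring: no proper coloring misses a color of an
  optimal one, and any proper modification that brings in no new color is again optimal. Since every
  optimal coloring is subject to the villainy bound, a coloring may first be changed into one with a
  larger class and only then be confronted with a forbidden configuration. The obstacle is that each
  configuration needs both classes with several vertices and suitable edges to place them on. The
  surplus \<open>card V - k\<close> supplies the classes. In triangle-free graphs with at least
  three colors the edges come from a minimal non-bipartite vertex set; elsewhere they come from a
  triangle, or from edges joining different classes. The sporadic graphs on five or six vertices are
  those where the surplus is two or three but the configurations do not fit.\<close>

text \<open>A list equation prescribes all values at once and simplifies to single equations.
  Outside \<open>xs\<close> the map follows a free \<open>h\<close>, so that it can be glued to a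
  bijection of the remaining vertices.\<close>

lemma list_map_extension:
  assumes "distinct xs" "distinct ys" "length xs = length ys"
  shows "\<exists>s. map s xs = ys \<and> (\<forall>x. x \<notin> set xs \<longrightarrow> s x = h x) \<and> bij_betw s (set xs) (set ys)"
proof -
  define s where "s x = (if x \<in> set xs then the (map_of (zip xs ys) x) else h x)" for x
  have m: "map s xs = ys"
    using assms by (intro nth_equalityI) (auto simp: s_def map_of_zip_nth)
  then have "bij_betw s (set xs) (set ys)"
    using assms(2) unfolding bij_betw_def by (metis distinct_map set_map)
  with m show ?thesis by (intro exI[of _ s]) (auto simp: s_def)
qed

locale fin_graph =
  fixes G :: "'a sgraph"
  assumes simple: "simple_graph G"
begin

abbreviation V :: "'a set" where "V \<equiv> verts G"
abbreviation k :: nat where "k \<equiv> chromatic_number G"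

definition adj :: "'a \<Rightarrow> 'a \<Rightarrow> bool" where
  "adj u v \<longleftrightarrow> {u, v} \<in> edges G"

text \<open>Only the number of colors is restricted, not their names. Recolorings can thus use
  arbitrary numbers without renaming them into \<open>{..<k}\<close>.\<close>

definition opt :: "('a \<Rightarrow> nat) \<Rightarrow> bool" where
  "opt f \<longleftrightarrow> proper_coloring G f \<and> card (f ` V) \<le> k"

lemma finite_V [simp]: "finite V"
  using simple by (simp add: simple_graph_def)

lemma adj_sym: "adj u v \<longleftrightarrow> adj v u"
  by (simp add: adj_def insert_commute)

lemma adj_V: assumes "adj u v" shows "u \<in> V" "v \<in> V" "u \<noteq> v"
proof -
  have "{u, v} \<subseteq> V" "card {u, v} = 2"
    using assms simple by (auto simp: adj_def simple_graph_def)
  then show "u \<in> V" "v \<in> V" "u \<noteq> v" by auto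
qed

lemma adj_irrefl [simp]: "\<not> adj u u"
  using adj_V by blast

lemma proper_iff: "proper_coloring G c \<longleftrightarrow> (\<forall>u v. adj u v \<longrightarrow> c u \<noteq> c v)"
  using adj_V by (auto simp: proper_coloring_def adj_def)

lemma proper_renaming:
  assumes "proper_coloring G f"
  obtains h where "inj_on h (f ` V)" "h ` f ` V = {..<card (f ` V)}"
    "proper_k_coloring G (card (f ` V)) (h \<circ> f)"
proof -
  obtain h where h: "bij_betw h (f ` V) {0..<card (f ` V)}"
    using ex_bij_betw_finite_nat finite_V by blast
  have inj: "inj_on h (f ` V)" and im: "h ` f ` V = {..<card (f ` V)}"
    using h by (simp_all add: bij_betw_def lessThan_atLeast0)
  have "proper_k_coloring G (card (f ` V)) (h \<circ> f)"
    using assms inj im unfolding proper_k_coloring_def proper_coloring_def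
    by (auto simp: inj_on_eq_iff image_comp)
  then show ?thesis using that inj im by blast
qed

lemma chromatic_number_le:
  assumes "proper_coloring G f"
  shows "k \<le> card (f ` V)"
  using proper_renaming[OF assms] unfolding chromatic_number_def by (metis Least_le)

lemma proper_k_coloring_opt:
  assumes "proper_k_coloring G k f"
  shows "opt f"
proof -
  have "card (f ` V) \<le> card {..<k}"
    using assms unfolding proper_k_coloring_def by (intro card_mono) auto
  with assms show ?thesis by (simp add: opt_def proper_k_coloring_def)
qed

lemma opt_card: "opt f \<Longrightarrow> card (f ` V) = k"
  using chromatic_number_le by (fastforce simp: opt_def)

lemma opt_proper: "opt f \<Longrightarrow> adj u v \<Longrightarrow> f u \<noteq> f v"
  by (auto simp: opt_def proper_iff)

lemma opt_exists: "\<exists>f. opt f"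
  using chromatic_number_coloring[OF simple] proper_k_coloring_opt by blast

end

text \<open>If \<open>u\<close> changes its color, the old color of \<open>u\<close> must be
  regained at another changed vertex, because the counts agree. With at most two changes, the two
  changed vertices exchange colors. If nothing changes, a vertex is transposed with itself, which
  requires that one exists.\<close>

lemma recoloring_two_is_swap:
  assumes fin: "finite (verts G)" and ne: "verts G \<noteq> {}"
    and counts: "same_color_counts G g c"
    and two: "card {v \<in> verts G. g v \<noteq> c v} \<le> 2"
  shows "\<exists>u\<in>verts G. \<exists>v\<in>verts G. \<forall>x\<in>verts G. g x = c (transpose u v x)"
proof -
  let ?D = "{v \<in> verts G. g v \<noteq> c v}"
  have moved: "\<exists>v\<in>?D. g v = c u \<and> v \<noteq> u" if "u \<in> ?D" for u
  proof (rule ccontr)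
    assume no: "\<not> ?thesis"
    then have less: "{v \<in> verts G. g v = c u} \<subset> {v \<in> verts G. c v = c u}"
      using that by auto
    have "card {v \<in> verts G. g v = c u} = card {v \<in> verts G. c v = c u}"
      using counts by (simp add: same_color_counts_def)
    moreover have "finite {v \<in> verts G. c v = c u}" using fin by simp
    ultimately show False using psubset_card_mono[OF _ less] by simp
  qed
  show ?thesis
  proof (cases "?D = {}")
    case True
    obtain u where "u \<in> verts G" using ne by blast
    moreover have "\<forall>x\<in>verts G. g x = c (transpose u u x)" using True by auto
    ultimately show ?thesis by blast
  next
    case False
    then obtain u where u: "u \<in> ?D" by blast
    then obtain v where v: "v \<in> ?D" "g v = c u" "v \<noteq> u" using moved by blast
    have "?D = {u, v}"
      using two u v fin by (intro card_seteq[symmetric]) auto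
    moreover then have "g u = c v" using moved[OF v(1)] by auto
    ultimately have "\<forall>x\<in>verts G. g x = c (transpose u v x)"
      using v by (auto simp: transpose_def)
    then show ?thesis using u v by blast
  qed
qed

locale villainy_two = fin_graph +
  assumes villainy: "villainy G = 2"
begin

text \<open>Otherwise every permuted coloring needs no repair and the villainy is 0. This later
  rules out edgeless and complete graphs.\<close>

lemma improper_permutation:
  "\<exists>f \<sigma>. opt f \<and> bij_betw \<sigma> V V \<and> \<not> proper_coloring G (f \<circ> \<sigma>)"
proof (rule ccontr)
  assume none: "\<not> ?thesis"
  have "coloring_villainy G c = 0" if c: "c \<in> permuted_colorings G" for c
  proof -
    have p: "proper_coloring G c"
      using c none proper_k_coloring_opt by (auto simp: permuted_colorings_def)
    have "same_color_counts G c c" by (simp add: same_color_counts_def)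
    with p have zero: "0 \<in> {card {v \<in> V. g v \<noteq> c v} | g. proper_coloring G g \<and> same_color_counts G g c}"
      by (intro CollectI exI[of _ c]) auto
    then show ?thesis
      unfolding coloring_villainy_def
      using Min_le[OF recoloring_sizes_finite[OF simple] zero] by simp
  qed
  then have "coloring_villainy G ` permuted_colorings G = {0}"
    using permuted_colorings_nonempty[OF simple] by auto
  then show False using villainy by (simp add: villainy_def)
qed

lemma V_nonempty: "V \<noteq> {}"
  using improper_permutation by (auto simp: proper_coloring_def)

lemma swap:
  assumes "opt f" and \<sigma>: "bij_betw \<sigma> V V"
  shows "\<exists>u\<in>V. \<exists>v\<in>V. \<forall>x y. adj x y \<longrightarrow> f (\<sigma> (transpose u v x)) \<noteq> f (\<sigma> (transpose u v y))"
proof -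
  obtain h where h: "inj_on h (f ` V)" "proper_k_coloring G (card (f ` V)) (h \<circ> f)"
    using proper_renaming assms by (metis opt_def)
  \<comment> \<open>Villainy refers to colors below \<open>k\<close>, hence the renaming
    \<open>h\<close>. Colors that differ after \<open>h\<close> already differ before it, so the
    conclusion passes back to \<open>f\<close>.\<close>
  let ?c = "h \<circ> f \<circ> \<sigma>"
  have c: "?c \<in> permuted_colorings G"
    using h \<sigma> opt_card[OF assms(1)] unfolding permuted_colorings_def by auto
  have "coloring_villainy G ?c \<le> 2"
    using villainy Max_ge[OF coloring_villainies_finite[OF simple] imageI[OF c]]
    unfolding villainy_def by simp
  moreover have "coloring_villainy G ?c \<in>
      {card {v \<in> V. g v \<noteq> ?c v} | g. proper_coloring G g \<and> same_color_counts G g ?c}"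
    unfolding coloring_villainy_def
    by (rule Min_in[OF recoloring_sizes_finite[OF simple] recoloring_sizes_nonempty[OF c]])
  ultimately obtain g where g: "proper_coloring G g" "same_color_counts G g ?c"
    "card {v \<in> V. g v \<noteq> ?c v} \<le> 2" by auto
  obtain u v where uv: "u \<in> V" "v \<in> V" "\<forall>x\<in>V. g x = ?c (transpose u v x)"
    using recoloring_two_is_swap[OF finite_V V_nonempty g(2,3)] by blast
  have "f (\<sigma> (transpose u v x)) \<noteq> f (\<sigma> (transpose u v y))" if "adj x y" for x y
    using that g(1) uv(3) adj_V[OF that] unfolding proper_iff by fastforce
  then show ?thesis using uv by blast
qed

lemma permutation_extension:
  assumes "distinct xs" "distinct ys" "length xs = length ys" "set xs \<subseteq> V" "set ys \<subseteq> V"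
  shows "\<exists>\<sigma>. bij_betw \<sigma> V V \<and> map \<sigma> xs = ys"
proof -
  have "card (V - set xs) = card (V - set ys)"
    using assms by (simp add: card_Diff_subset distinct_card)
  then obtain h where h: "bij_betw h (V - set xs) (V - set ys)"
    using finite_same_card_bij[of "V - set xs" "V - set ys"] by auto
  obtain s where s: "map s xs = ys" "\<forall>x. x \<notin> set xs \<longrightarrow> s x = h x"
    "bij_betw s (set xs) (set ys)"
    using list_map_extension[OF assms(1-3)] by metis
  have "bij_betw s (set xs \<union> (V - set xs)) (set ys \<union> (V - set ys))"
  proof (rule bij_betw_combine)
    show "bij_betw s (V - set xs) (V - set ys)"
      using h s(2) by (subst bij_betw_cong[where g = h]) auto
  qed (use s in auto)
  moreover have "set xs \<union> (V - set xs) = V" "set ys \<union> (V - set ys) = V" using assms by auto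
  ultimately show ?thesis using s(1) by metis
qed

section \<open>Configurations excluded by a prescribed placement of colors\<close>

lemma swap_extension:
  assumes "opt f" "distinct xs" "distinct ys" "length xs = length ys" "set xs \<subseteq> V" "set ys \<subseteq> V"
  obtains \<sigma> u v where "bij_betw \<sigma> V V" "map \<sigma> xs = ys" "u \<in> V" "v \<in> V"
    "\<forall>x y. adj x y \<longrightarrow> f (\<sigma> (transpose u v x)) \<noteq> f (\<sigma> (transpose u v y))"
  using permutation_extension[OF assms(2-)] swap[OF assms(1)] by metis

text \<open>If both or neither of the ends are transposed, the edge stays monochromatic; the same
  happens if the transposed vertices have equal colors, since then nothing changes.\<close>

lemma monochromatic_edge:
  assumes "\<forall>x y. adj x y \<longrightarrow> c (transpose u v x) \<noteq> (c (transpose u v y) :: nat)"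
    and "adj x y" "c x = c y"
  shows "c u \<noteq> c v" "x \<in> {u, v} \<longleftrightarrow> y \<notin> {u, v}"
  using assms(1)[rule_format, OF assms(2)] assms(3) adj_V[OF assms(2)] by (auto simp: transpose_def split: if_splits)

text \<open>The four equal colors are put on two disjoint edges. Each edge then contains exactly one
  transposed vertex, so these two have equal colors and their exchange is void.\<close>

lemma four_alike:
  assumes "opt f" "distinct [y1, y2, y3, y4]" "{y1, y2, y3, y4} \<subseteq> V"
    and "f y1 = f y2" "f y2 = f y3" "f y3 = f y4"
    and "adj a b" "adj c d" "distinct [a, b, c, d]"
  shows False
proof -
  obtain \<sigma> u v where s: "map \<sigma> [a,b,c,d] = [y1,y2,y3,y4]"
    "\<forall>x y. adj x y \<longrightarrow> f (\<sigma> (transpose u v x)) \<noteq> f (\<sigma> (transpose u v y))"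
    by (rule swap_extension[OF assms(1,9,2)]) (use assms adj_V in auto)
  have "f (\<sigma> u) \<noteq> f (\<sigma> v)" "a \<in> {u, v} \<longleftrightarrow> b \<notin> {u, v}" "c \<in> {u, v} \<longleftrightarrow> d \<notin> {u, v}"
    using monochromatic_edge[of "\<lambda>x. f (\<sigma> x)", OF s(2)] assms s(1) by auto
  then show False using s(1) assms by auto
qed

text \<open>On a monochromatic triangle every edge would have exactly one transposed end, which is
  impossible on an odd cycle.\<close>

lemma three_alike:
  assumes "opt f" "distinct [y1, y2, y3]" "{y1, y2, y3} \<subseteq> V"
    and "f y1 = f y2" "f y2 = f y3"
    and "adj a b" "adj b c" "adj c a"
  shows False
proof -
  have d: "distinct [a, b, c]" using assms adj_V by auto
  obtain \<sigma> u v where s: "map \<sigma> [a,b,c] = [y1,y2,y3]"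
    "\<forall>x y. adj x y \<longrightarrow> f (\<sigma> (transpose u v x)) \<noteq> f (\<sigma> (transpose u v y))"
    by (rule swap_extension[OF assms(1) d assms(2)]) (use assms adj_V in auto)
  note m = monochromatic_edge(2)[of "\<lambda>x. f (\<sigma> x)", OF s(2)]
  have "a \<in> {u, v} \<longleftrightarrow> b \<notin> {u, v}" "b \<in> {u, v} \<longleftrightarrow> c \<notin> {u, v}" "c \<in> {u, v} \<longleftrightarrow> a \<notin> {u, v}"
    using m[OF assms(6)] m[OF assms(7)] m[OF assms(8)] assms(4,5) s(1) by auto
  then show False by blast
qed

lemma three_pairs:
  assumes "opt f" "{y1, y1', y2, y2', y3, y3'} \<subseteq> V"
    and "y1 \<noteq> y1'" "y2 \<noteq> y2'" "y3 \<noteq> y3'"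
    and "f y1 = f y1'" "f y2 = f y2'" "f y3 = f y3'" "f y1 \<noteq> f y2" "f y1 \<noteq> f y3" "f y2 \<noteq> f y3"
    and "adj a a'" "adj b b'" "adj c c'" "distinct [a, a', b, b', c, c']"
  shows False
proof -
  have d: "distinct [y1, y1', y2, y2', y3, y3']" using assms by auto
  obtain \<sigma> u v where s: "map \<sigma> [a,a',b,b',c,c'] = [y1,y1',y2,y2',y3,y3']"
    "\<forall>x y. adj x y \<longrightarrow> f (\<sigma> (transpose u v x)) \<noteq> f (\<sigma> (transpose u v y))"
    by (rule swap_extension[OF assms(1,15) d]) (use assms adj_V in auto)
  have "a \<in> {u, v} \<longleftrightarrow> a' \<notin> {u, v}" "b \<in> {u, v} \<longleftrightarrow> b' \<notin> {u, v}" "c \<in> {u, v} \<longleftrightarrow> c' \<notin> {u, v}"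
    using monochromatic_edge(2)[of "\<lambda>x. f (\<sigma> x)", OF s(2)] assms s(1) by auto
  then show False using assms(15) by auto
qed

lemma three_and_two_no_C5:
  assumes "opt f" "{y1, y2, y3, z1, z2} \<subseteq> V" "distinct [y1, y2, y3]" "z1 \<noteq> z2"
    and "f y1 = f y2" "f y2 = f y3" "f z1 = f z2" "f y1 \<noteq> f z1"
    and "adj a b" "adj b c" "adj c d" "adj d e" "adj e a" "distinct [a, b, c, d, e]"
  shows False
proof -
  have d: "distinct [y1, y2, y3, z1, z2]" using assms by auto
  obtain \<sigma> u v where s: "map \<sigma> [a,b,c,d,e] = [y1,y2,y3,z1,z2]"
    "\<forall>x y. adj x y \<longrightarrow> f (\<sigma> (transpose u v x)) \<noteq> f (\<sigma> (transpose u v y))"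
    by (rule swap_extension[OF assms(1,14) d]) (use assms adj_V in auto)
  note m = monochromatic_edge[of "\<lambda>x. f (\<sigma> x)", OF s(2)]
  have c: "f (\<sigma> u) \<noteq> f (\<sigma> v)" and
    m': "a \<in> {u, v} \<longleftrightarrow> b \<notin> {u, v}" "b \<in> {u, v} \<longleftrightarrow> c \<notin> {u, v}" "d \<in> {u, v} \<longleftrightarrow> e \<notin> {u, v}"
    using m[OF assms(9)] m(2)[OF assms(10)] m(2)[OF assms(12)] assms s(1) by auto
  \<comment> \<open>Otherwise both \<open>a\<close> and \<open>c\<close> are transposed and none is
    left for the edge \<open>d e\<close>. Exchanging \<open>b\<close> with \<open>d\<close> spoils
    the edge \<open>c d\<close>, and exchanging it with \<open>e\<close> spoils
    \<open>e a\<close>.\<close>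
  have "b \<in> {u, v}" using c m' s(1) assms by auto
  then show False
    using m' s(1) s(2)[rule_format, OF assms(11)] s(2)[rule_format, OF assms(13)] assms
    by (auto simp: transpose_def split: if_splits)
qed

text \<open>Each edge receives one of the two colors, so an end of the first is exchanged with an
  end of the second. The two cross pairs that become monochromatic must be nonadjacent; which two
  depends on the exchanged ends.\<close>

lemma two_pairs:
  assumes "opt f" "{y1, y1', y2, y2'} \<subseteq> V" "y1 \<noteq> y1'" "y2 \<noteq> y2'"
    and "f y1 = f y1'" "f y2 = f y2'" "f y1 \<noteq> f y2"
    and "adj a a'" "adj b b'" "distinct [a, a', b, b']"
  shows "\<not> adj a b \<and> \<not> adj a' b' \<or> \<not> adj a b' \<and> \<not> adj a' b"
proof -
  have d: "distinct [y1, y1', y2, y2']" using assms by auto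
  obtain \<sigma> u v where s: "map \<sigma> [a,a',b,b'] = [y1,y1',y2,y2']"
    "\<forall>x y. adj x y \<longrightarrow> f (\<sigma> (transpose u v x)) \<noteq> f (\<sigma> (transpose u v y))"
    by (rule swap_extension[OF assms(1,10) d]) (use assms adj_V in auto)
  have m: "a \<in> {u, v} \<longleftrightarrow> a' \<notin> {u, v}" "b \<in> {u, v} \<longleftrightarrow> b' \<notin> {u, v}"
    using monochromatic_edge(2)[of "\<lambda>x. f (\<sigma> x)", OF s(2)] assms s(1) by auto
  then show ?thesis
    using s(1) s(2)[rule_format, of a b] s(2)[rule_format, of a' b'] s(2)[rule_format, of a b'] s(2)[rule_format, of a' b] assms
    by (auto simp: transpose_def split: if_splits)
qed

text \<open>Both ends of the edge receive the same color. The repair exchanges one end with some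
  outside vertex \<open>z\<close>, which then has the color of the other end and so cannot be
  adjacent to it.\<close>

lemma one_pair:
  assumes "opt f" "{y, y'} \<subseteq> V" "y \<noteq> y'" "f y = f y'" "adj a b"
  shows "\<exists>z\<in>V - {a, b}. \<not> adj z a \<or> \<not> adj z b"
proof -
  have d: "distinct [y, y']" "distinct [a, b]" using assms adj_V by auto
  obtain \<sigma> u v where s: "map \<sigma> [a,b] = [y,y']" "u \<in> V" "v \<in> V"
    "\<forall>x y. adj x y \<longrightarrow> f (\<sigma> (transpose u v x)) \<noteq> f (\<sigma> (transpose u v y))"
    by (rule swap_extension[OF assms(1) d(2,1)]) (use assms adj_V in auto)
  have m: "a \<in> {u, v} \<longleftrightarrow> b \<notin> {u, v}" "f (\<sigma> u) \<noteq> f (\<sigma> v)"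
    using monochromatic_edge[of "\<lambda>x. f (\<sigma> x)", OF s(4)] assms s(1) by auto
  have "\<not> adj v b" if "u = a" using m s(1) s(4)[rule_format, of v b] that assms(4) by (auto simp: transpose_def split: if_splits)
  moreover have "\<not> adj u b" if "v = a" using m s(1) s(4)[rule_format, of u b] that assms(4) by (auto simp: transpose_def split: if_splits)
  moreover have "\<not> adj v a" if "u = b" using m s(1) s(4)[rule_format, of v a] that assms(4) by (auto simp: transpose_def split: if_splits)
  moreover have "\<not> adj u a" if "v = b" using m s(1) s(4)[rule_format, of u a] that assms(4) by (auto simp: transpose_def split: if_splits)
  ultimately show ?thesis using m s(2,3) by auto
qed

end

section \<open>Recognizing the listed graphs\<close>

definition listed :: "'a sgraph \<Rightarrow> bool" where
  "listed G \<longleftrightarrow> (\<exists>t\<ge>2. G \<simeq> complete_bipartite_graph 1 t)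
    \<or> (card (verts G) = 6 \<and> connected_graph G \<and>
        (\<exists>X Y. bipartition G X Y \<and> card X = 3 \<and> card Y = 3))
    \<or> (G \<simeq> path_graph 4 \<or> G \<simeq> path_graph 4 \<uplus> complete_graph 1
        \<or> G \<simeq> path_graph 4 \<uplus> complete_graph 2)
    \<or> (G \<simeq> cycle_graph 4 \<or> G \<simeq> cycle_graph 4 \<uplus> complete_graph 1
        \<or> G \<simeq> cycle_graph 4 \<uplus> complete_graph 2)
    \<or> G \<simeq> cycle_graph 5
    \<or> (G \<simeq> complete_graph 2 \<uplus> complete_graph 2
        \<or> G \<simeq> complete_graph 2 \<uplus> complete_graph 2 \<uplus> complete_graph 2)
    \<or> G \<simeq> complete_graph 3 \<uplus> complete_graph 2
    \<or> G \<simeq> complete_graph 3 \<uplus> complete_graph 3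
    \<or> G \<simeq> complete_graph 2 \<uplus> complete_graph 2 \<uplus> complete_graph 1
    \<or> (card (verts G) \<ge> 4 \<and>
        (\<exists>v\<in>verts G. (degree G v = 0 \<or> degree G v = 1) \<and> is_complete (delete_vertex G v)))
    \<or> (\<exists>r\<ge>1. G \<simeq> path_graph 3 \<uplus> empty_graph r)
    \<or> (\<exists>r\<ge>1. G \<simeq> complete_graph 2 \<uplus> empty_graph r)"

lemma verts_standard [simp]:
  "verts (path_graph n) = {..<n}" "verts (cycle_graph n) = {..<n}"
  "verts (complete_graph n) = {..<n}" "verts (empty_graph n) = {..<n}"
  "verts (H \<uplus> K) = verts H <+> verts K"
  by (simp_all add: path_graph_def cycle_graph_def complete_graph_def empty_graph_def disjoint_union_def)

lemma edges_standard [simp]: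
  "{i, j} \<in> edges (path_graph n) \<longleftrightarrow> (j = Suc i \<and> j < n) \<or> (i = Suc j \<and> i < n)"
  "{i, j} \<in> edges (complete_graph n) \<longleftrightarrow> i < n \<and> j < n \<and> i \<noteq> j"
  "e \<notin> edges (empty_graph n)"
  "{i, j} \<in> edges (cycle_graph n) \<longleftrightarrow> i < n \<and> j = Suc i mod n \<or> j < n \<and> i = Suc j mod n"
  by (auto simp: path_graph_def complete_graph_def empty_graph_def cycle_graph_def doubleton_eq_iff)

lemma loopless_standard [simp]:
  "{x} \<notin> edges (path_graph n)" "{x} \<notin> edges (complete_graph n)"
  "n \<noteq> 1 \<Longrightarrow> {x} \<notin> edges (cycle_graph n)"
  "{Inl a} \<in> edges (H \<uplus> K) \<longleftrightarrow> {a} \<in> edges H"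
  "{Inr b} \<in> edges (H \<uplus> K) \<longleftrightarrow> {b} \<in> edges K"
proof -
  show "{x} \<notin> edges (path_graph n)" "{x} \<notin> edges (complete_graph n)"
    by (auto simp: path_graph_def complete_graph_def)
  show "{x} \<notin> edges (cycle_graph n)" if "n \<noteq> 1"
    using that by (auto simp: cycle_graph_def mod_Suc split: if_splits intro!: gr0I)
  have l: "{Inl a} = Inl ` {a}" and r: "{Inr b} = Inr ` {b}" by auto
  show "{Inl a} \<in> edges (H \<uplus> K) \<longleftrightarrow> {a} \<in> edges H"
    unfolding l disjoint_union_def by (auto simp: inj_image_eq_iff simp del: image_insert)
  show "{Inr b} \<in> edges (H \<uplus> K) \<longleftrightarrow> {b} \<in> edges K"
    unfolding r disjoint_union_def by (auto simp: inj_image_eq_iff simp del: image_insert)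
qed

lemma edges_disjoint_union [simp]:
  "{Inl a, Inl b} \<in> edges (H \<uplus> K) \<longleftrightarrow> {a, b} \<in> edges H"
  "{Inr c, Inr d} \<in> edges (H \<uplus> K) \<longleftrightarrow> {c, d} \<in> edges K"
  "{Inl a, Inr c} \<notin> edges (H \<uplus> K)"
  "{Inr c, Inl a} \<notin> edges (H \<uplus> K)"
proof -
  have l: "{Inl a, Inl b} = Inl ` {a, b}" and r: "{Inr c, Inr d} = Inr ` {c, d}" by auto
  show "{Inl a, Inl b} \<in> edges (H \<uplus> K) \<longleftrightarrow> {a, b} \<in> edges H"
    unfolding l disjoint_union_def by (auto simp: inj_image_eq_iff simp del: image_insert)
  show "{Inr c, Inr d} \<in> edges (H \<uplus> K) \<longleftrightarrow> {c, d} \<in> edges K"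
    unfolding r disjoint_union_def by (auto simp: inj_image_eq_iff simp del: image_insert)
qed (auto simp: disjoint_union_def)

lemma lessThan_small: "{..<1::nat} = {0}" "{..<2::nat} = {0, 1}" "{..<3::nat} = {0, 1, 2}"
  "{..<4::nat} = {0, 1, 2, 3}" "{..<5::nat} = {0, 1, 2, 3, 4}"
  by auto

lemma Plus_insert: "insert a A <+> B = insert (Inl a) (A <+> B)"
  "{} <+> insert b B = insert (Inr b) ({} <+> B)"
  by auto

lemmas standard_graphs = lessThan_small Plus_insert

section \<open>Isomorphism criteria and bipartite graphs with two vertices on each side\<close>

context fin_graph
begin

text \<open>For explicit lists, \<open>sorted_wrt\<close> on the zipped list unfolds to one
  condition per unordered pair of positions; the diagonal is left to \<open>loops\<close>.
  Isomorphisms with concrete small graphs thereby become simplification problems.\<close>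

lemma iso_listI:
  assumes "distinct xs" "set xs = V" "distinct ys" "set ys = verts H" "length xs = length ys"
    and loops: "\<And>y. y \<in> set ys \<Longrightarrow> {y} \<notin> edges H"
    and e: "sorted_wrt (\<lambda>p q. adj (fst p) (fst q) \<longleftrightarrow> {snd p, snd q} \<in> edges H) (zip xs ys)"
  shows "G \<simeq> H"
proof -
  obtain s where s: "map s xs = ys" "bij_betw s (set xs) (set ys)"
    using list_map_extension[OF assms(1,3,5)] by metis
  have e': "adj (xs ! i) (xs ! j) \<longleftrightarrow> {ys ! i, ys ! j} \<in> edges H" if "i < j" "j < length xs" for i j
    using e that assms(5) unfolding sorted_wrt_iff_nth_less by auto
  have "{u, v} \<in> edges G \<longleftrightarrow> {s u, s v} \<in> edges H" if uv: "u \<in> V" "v \<in> V" for u v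
  proof -
    obtain i j where ij: "i < length xs" "u = xs ! i" "j < length xs" "v = xs ! j"
      using uv assms(2) by (metis in_set_conv_nth)
    have sy: "s (xs ! i) = ys ! i" "s (xs ! j) = ys ! j"
      using nth_map[of _ xs s] s(1) ij by auto
    consider "i < j" | "i = j" | "j < i" by linarith
    then show ?thesis
    proof cases
      case 1 then show ?thesis using e'[of i j] ij sy by (simp add: adj_def)
    next
      case 2 then show ?thesis
        using ij sy loops[of "ys ! i"] assms(5) adj_irrefl[of u, unfolded adj_def] by simp
    next
      case 3 then show ?thesis using e'[of j i] ij sy by (simp add: adj_def insert_commute)
    qed
  qed
  then show ?thesis using s assms(2,4) unfolding graph_iso_def by metis
qed

text \<open>Serves the two infinite families with isolated vertices: only the nontrivial part is
  listed, and the remaining vertices are enumerated in any order.\<close>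

lemma iso_list_isolatedI:
  assumes "distinct xs" "set xs \<subseteq> V" "distinct ys" "set ys = verts H" "length xs = length ys"
    and loops: "\<And>y. y \<in> set ys \<Longrightarrow> {y} \<notin> edges H"
    and e: "sorted_wrt (\<lambda>p q. adj (fst p) (fst q) \<longleftrightarrow> {snd p, snd q} \<in> edges H) (zip xs ys)"
    and iso: "\<And>u v. u \<notin> set xs \<Longrightarrow> \<not> adj u v"
  shows "G \<simeq> H \<uplus> empty_graph (card (V - set xs))"
proof -
  obtain zs where zs: "distinct zs" "set zs = V - set xs"
    using finite_distinct_list[of "V - set xs"] by auto
  let ?n = "card (V - set xs)"
  have len: "length zs = ?n" using zs by (metis distinct_card)
  show ?thesis
  proof (rule iso_listI[where xs = "xs @ zs" and ys = "map Inl ys @ map Inr [0..<?n]"])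
    show "distinct (xs @ zs)" "set (xs @ zs) = V"
      using assms(1,2) zs by auto
    show "distinct (map Inl ys @ map Inr [0..<?n])"
      using assms(3) by (auto simp: distinct_map)
    show "set (map Inl ys @ map Inr [0..<?n]) = verts (H \<uplus> empty_graph ?n)"
      using assms(4) by auto
    show "length (xs @ zs) = length (map Inl ys @ map Inr [0..<?n])"
      using assms(5) len by simp
    show "{y} \<notin> edges (H \<uplus> empty_graph ?n)" if "y \<in> set (map Inl ys @ map Inr [0..<?n])" for y
      using that loops by auto
    let ?P = "\<lambda>p q. adj (fst p) (fst q) \<longleftrightarrow> {snd p, snd q} \<in> edges (H \<uplus> empty_graph ?n)"
    have z: "zip (xs @ zs) (map Inl ys @ map Inr [0..<?n]) = zip xs (map Inl ys) @ zip zs (map Inr [0..<?n])"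
      using assms(5) by simp
    have na: "\<not> adj u v" if "v \<in> set zs" for u v
      using iso[of v u] that zs(2) by (auto simp: adj_sym)
    have "sorted_wrt ?P (zip xs (map Inl ys))"
      using e by (simp add: zip_map2 sorted_wrt_map case_prod_beta)
    moreover have "sorted_wrt ?P (zip zs (map Inr [0..<?n]))"
      unfolding sorted_wrt_iff_nth_less using na len by auto
    moreover have "?P p q" if "p \<in> set (zip xs (map Inl ys))" "q \<in> set (zip zs (map Inr [0..<?n]))" for p q
    proof -
      have "snd p \<in> set (map Inl ys)" "snd q \<in> set (map Inr [0..<?n])" "fst q \<in> set zs"
        using that by (metis prod.collapse set_zip_rightD set_zip_leftD)+
      then show ?thesis using na by auto
    qed
    ultimately show "sorted_wrt ?P (zip (xs @ zs) (map Inl ys @ map Inr [0..<?n]))"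
      unfolding z by (simp add: sorted_wrt_append)
  qed
qed

lemma k_ge_2: "adj x y \<Longrightarrow> 2 \<le> k"
proof -
  assume xy: "adj x y"
  obtain f where f: "opt f" using opt_exists by blast
  then have "f x \<noteq> f y" using xy opt_proper by blast
  then have "card {f x, f y} = 2" by simp
  moreover have "card {f x, f y} \<le> card (f ` V)"
    using adj_V[OF xy] by (intro card_mono) auto
  ultimately show ?thesis using opt_card[OF f] by simp
qed

text \<open>Two sides of two vertices each without isolated vertices have a perfect matching
  \<open>w x\<close>, \<open>y z\<close>. The order is chosen so that a third edge can only be
  \<open>x y\<close>, and \<open>w z\<close> is the fourth. What remains is two disjoint edges, a
  path or a 4-cycle.\<close>

lemma four_vertices:
  assumes d: "distinct [a1, a2, b1, b2]" and "\<not> adj a1 a2" "\<not> adj b1 b2"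
    and "adj a1 b1 \<or> adj a1 b2" "adj a2 b1 \<or> adj a2 b2" "adj a1 b1 \<or> adj a2 b1" "adj a1 b2 \<or> adj a2 b2"
  obtains w x y z where "{w, x, y, z} = {a1, a2, b1, b2}" "distinct [w, x, y, z]"
    "adj w x" "adj y z" "\<not> adj w y" "\<not> adj x z" "adj w z \<longrightarrow> adj x y"
proof -
  have s: "{a1, b1, a2, b2} = {a1, a2, b1, b2}" "{a2, b2, a1, b1} = {a1, a2, b1, b2}"
    "{a1, b2, a2, b1} = {a1, a2, b1, b2}" "{a2, b1, a1, b2} = {a1, a2, b1, b2}" by auto
  consider "adj a1 b1" "adj a2 b2" | "adj a1 b2" "adj a2 b1" using assms by blast
  then show thesis
  proof cases
    case 1
    then show ?thesis
      using that[OF s(1)] that[OF s(2)] assms by (auto simp: adj_sym)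
  next
    case 2
    then show ?thesis
      using that[OF s(3)] that[OF s(4)] assms by (auto simp: adj_sym)
  qed
qed

lemma listed_four:
  assumes "distinct [w, x, y, z]" "{w, x, y, z} \<subseteq> V"
    and "adj w x" "adj y z" "\<not> adj w y" "\<not> adj x z" "adj w z \<longrightarrow> adj x y"
  shows "V = {w, x, y, z} \<Longrightarrow> listed G"
    and "V = {w, x, y, z, i} \<Longrightarrow> i \<notin> {w, x, y, z} \<Longrightarrow> (\<And>u. \<not> adj u i) \<Longrightarrow> listed G"
    and "V = {w, x, y, z, i, j} \<Longrightarrow> distinct [w, x, y, z, i, j] \<Longrightarrow> adj i j \<Longrightarrow>
      \<forall>u\<in>{w, x, y, z}. \<not> adj u i \<and> \<not> adj u j \<Longrightarrow> listed G"
proof -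
  consider (K) "\<not> adj x y" "\<not> adj w z" | (P) "adj x y" "\<not> adj w z" | (C) "adj x y" "adj w z"
    using assms by blast
  note c = this
  show "listed G" if V: "V = {w, x, y, z}"
    using c
  proof cases
    case K
    have "G \<simeq> complete_graph 2 \<uplus> complete_graph 2"
      by (rule iso_listI[where xs = "[w, x, y, z]" and ys = "[Inl 0, Inl 1, Inr 0, Inr 1]"])
        (use assms(1,3-7) K V in \<open>auto simp: standard_graphs\<close>)
    then show ?thesis by (simp add: listed_def)
  next
    case P
    have "G \<simeq> path_graph 4"
      by (rule iso_listI[where xs = "[w, x, y, z]" and ys = "[0, 1, 2, 3]"])
        (use assms(1,3-7) P V in \<open>auto simp: standard_graphs\<close>)
    then show ?thesis by (simp add: listed_def)
  next
    case C
    have "G \<simeq> cycle_graph 4"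
      by (rule iso_listI[where xs = "[w, x, y, z]" and ys = "[0, 1, 2, 3]"])
        (use assms(1,3-7) C V in \<open>auto simp: standard_graphs\<close>)
    then show ?thesis by (simp add: listed_def)
  qed
  show "listed G" if V: "V = {w, x, y, z, i}" "i \<notin> {w, x, y, z}" "\<And>u. \<not> adj u i"
    using c
  proof cases
    case K
    have "G \<simeq> complete_graph 2 \<uplus> complete_graph 2 \<uplus> complete_graph 1"
      by (rule iso_listI[where xs = "[w, x, y, z, i]" and
            ys = "[Inl (Inl 0), Inl (Inl 1), Inl (Inr 0), Inl (Inr 1), Inr 0]"])
        (use assms(1,3-7) K V in \<open>auto simp: standard_graphs\<close>)
    then show ?thesis by (simp add: listed_def)
  next
    case P
    have "G \<simeq> path_graph 4 \<uplus> complete_graph 1"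
      by (rule iso_listI[where xs = "[w, x, y, z, i]" and ys = "[Inl 0, Inl 1, Inl 2, Inl 3, Inr 0]"])
        (use assms(1,3-7) P V in \<open>auto simp: standard_graphs\<close>)
    then show ?thesis by (simp add: listed_def)
  next
    case C
    have "G \<simeq> cycle_graph 4 \<uplus> complete_graph 1"
      by (rule iso_listI[where xs = "[w, x, y, z, i]" and ys = "[Inl 0, Inl 1, Inl 2, Inl 3, Inr 0]"])
        (use assms(1,3-7) C V in \<open>auto simp: standard_graphs\<close>)
    then show ?thesis by (simp add: listed_def)
  qed
  show "listed G" if V: "V = {w, x, y, z, i, j}" "distinct [w, x, y, z, i, j]" "adj i j"
    "\<forall>u\<in>{w, x, y, z}. \<not> adj u i \<and> \<not> adj u j"
    using c
  proof cases
    case K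
    have "G \<simeq> complete_graph 2 \<uplus> complete_graph 2 \<uplus> complete_graph 2"
      by (rule iso_listI[where xs = "[w, x, y, z, i, j]" and
            ys = "[Inl (Inl 0), Inl (Inl 1), Inl (Inr 0), Inl (Inr 1), Inr 0, Inr 1]"])
        (use assms(1,3-7) K V in \<open>auto simp: standard_graphs\<close>)
    then show ?thesis by (simp add: listed_def)
  next
    case P
    have "G \<simeq> path_graph 4 \<uplus> complete_graph 2"
      by (rule iso_listI[where xs = "[w, x, y, z, i, j]" and ys = "[Inl 0, Inl 1, Inl 2, Inl 3, Inr 0, Inr 1]"])
        (use assms(1,3-7) P V in \<open>auto simp: standard_graphs\<close>)
    then show ?thesis by (simp add: listed_def)
  next
    case C
    have "G \<simeq> cycle_graph 4 \<uplus> complete_graph 2"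
      by (rule iso_listI[where xs = "[w, x, y, z, i, j]" and ys = "[Inl 0, Inl 1, Inl 2, Inl 3, Inr 0, Inr 1]"])
        (use assms(1,3-7) C V in \<open>auto simp: standard_graphs\<close>)
    then show ?thesis by (simp add: listed_def)
  qed
qed

end

section \<open>Stars\<close>

lemma card_2_obtain:
  assumes "card A = 2"
  obtains a b where "A = {a, b}" "a \<noteq> b"
  using assms card_2_iff by metis

lemma card_3_obtain:
  assumes "card A = 3"
  obtains a b c where "A = {a, b, c}" "distinct [a, b, c]"
  using assms card_3_iff by (metis distinct_length_2_or_more distinct_singleton)

lemma three_of_card:
  assumes "3 \<le> card A"
  obtains a b c where "{a, b, c} \<subseteq> A" "distinct [a, b, c]"
  using assms by (metis card_3_obtain obtain_subset_with_card_n)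

lemma four_of_card:
  assumes "4 \<le> card A"
  obtains a b c d where "{a, b, c, d} \<subseteq> A" "distinct [a, b, c, d]"
proof -
  obtain B where B: "B \<subseteq> A" "card B = Suc 3"
    using obtain_subset_with_card_n[OF assms] by auto
  then obtain a C where "B = insert a C" "a \<notin> C" "card C = 3"
    unfolding card_Suc_eq by blast
  moreover then obtain b c d where "C = {b, c, d}" "distinct [b, c, d]" using card_3_obtain by metis
  ultimately show thesis using that[of a b c d] B(1) by auto
qed

context villainy_two
begin

lemma some_edge: "\<exists>x y. adj x y"
  using improper_permutation by (auto simp: proper_iff)

text \<open>A monochromatic edge in a permuted optimal coloring has its colors taken from two
  distinct vertices of equal color, and these are nonadjacent.\<close>

lemma not_complete: "\<exists>x\<in>V. \<exists>y\<in>V. x \<noteq> y \<and> \<not> adj x y"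
proof (rule ccontr)
  assume c: "\<not> ?thesis"
  obtain f \<sigma> where f: "opt f" "bij_betw \<sigma> V V" "\<not> proper_coloring G (f \<circ> \<sigma>)"
    using improper_permutation by blast
  then obtain x y where xy: "adj x y" "f (\<sigma> x) = f (\<sigma> y)" by (auto simp: proper_iff)
  then have "\<sigma> x \<noteq> \<sigma> y" "\<sigma> x \<in> V" "\<sigma> y \<in> V"
    using adj_V[OF xy(1)] f(2) by (auto simp: bij_betw_def inj_on_def)
  then show False using c xy(2) f(1) opt_proper by blast
qed

lemma star_listed:
  assumes z: "\<And>u v. adj u v \<Longrightarrow> u = z \<or> v = z"
  shows "listed G"
proof -
  define L where "L = {v. adj z v}"
  have zl: "\<exists>l. adj z l" using some_edge z adj_sym by metis
  have L: "L \<subseteq> V" "z \<notin> L" "L \<noteq> {}" and zV: "z \<in> V"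
    using zl adj_V by (auto simp: L_def)
  have "finite L" using L(1) finite_V by (rule finite_subset)
  note L = L this
  have adj_iff: "adj u v \<longleftrightarrow> u = z \<and> v \<in> L \<or> v = z \<and> u \<in> L" for u v
    using z adj_sym by (auto simp: L_def)
  define R where "R = V - insert z L"
  have "finite R" by (simp add: R_def)
  have "card L \<noteq> 0" using L by simp
  \<comment> \<open>\<open>L\<close> collects the leaves and \<open>R\<close> the isolated vertices.
    The first three cases are listed graphs; the last is contradictory.\<close>
  then consider (1) "card L = 1" | (2) "card L \<ge> 2" "R = {}" | (3) "card L = 2" "R \<noteq> {}"
    | (4) "card L \<ge> 3" "R \<noteq> {}" by linarith
  then show ?thesis
  proof cases
    case 1
    then obtain l where l: "L = {l}" by (auto simp: card_1_singleton_iff)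
    have "R \<noteq> {}"
    proof
      assume "R = {}"
      then have "V = {z, l}" using l zV L by (auto simp: R_def)
      then show False using not_complete adj_iff l by auto
    qed
    have "G \<simeq> complete_graph 2 \<uplus> empty_graph (card (V - set [z, l]))"
      by (rule iso_list_isolatedI[where ys = "[0, 1]"])
        (use l L zV adj_iff in \<open>auto simp: standard_graphs\<close>)
    moreover have "V - set [z, l] = R" using l by (simp add: R_def)
    ultimately show ?thesis using \<open>finite R\<close> \<open>R \<noteq> {}\<close>
      unfolding listed_def by (metis One_nat_def Suc_leI card_gt_0_iff)
  next
    case 2
    then have V: "V = insert z L" using L zV by (auto simp: R_def)
    obtain h where h: "bij_betw h L {..<card L}"
      using ex_bij_betw_finite_nat[OF L(4)] by (auto simp: lessThan_atLeast0)
    let ?s = "\<lambda>x. if x = z then Inl 0 else Inr (h x)"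
    have hL: "h x < card L" if "x \<in> L" for x using h that by (auto simp: bij_betw_def)
    have "bij_betw ?s V (verts (complete_bipartite_graph 1 (card L)))"
      using h L(2) unfolding V complete_bipartite_graph_def bij_betw_def inj_on_def
      by (auto simp: image_iff)
    moreover have "{u, v} \<in> edges G \<longleftrightarrow> {?s u, ?s v} \<in> edges (complete_bipartite_graph 1 (card L))"
      if "u \<in> V" "v \<in> V" for u v
      using that hL L(2) adj_iff[of u v] unfolding V adj_def complete_bipartite_graph_def
      by (auto simp: doubleton_eq_iff)
    ultimately have "G \<simeq> complete_bipartite_graph 1 (card L)"
      unfolding graph_iso_def by blast
    then show ?thesis using 2 unfolding listed_def by blast
  next
    case 3
    then obtain a b where l: "L = {a, b}" "a \<noteq> b" using card_2_obtain by blast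
    have "G \<simeq> path_graph 3 \<uplus> empty_graph (card (V - set [a, z, b]))"
      by (rule iso_list_isolatedI[where ys = "[0, 1, 2]"])
        (use l L zV adj_iff in \<open>auto simp: standard_graphs\<close>)
    moreover have "V - set [a, z, b] = R" using l by (auto simp: R_def)
    ultimately show ?thesis using \<open>finite R\<close> \<open>R \<noteq> {}\<close>
      unfolding listed_def by (metis One_nat_def Suc_leI card_gt_0_iff)
  next
    case 4
    obtain a b c where l: "{a, b, c} \<subseteq> L" "distinct [a, b, c]" using three_of_card 4 by blast
    obtain i where i: "i \<in> R" using 4 by blast
    define f where "f x = (if x \<in> {z, i} then 0 else 1 :: nat)" for x
    have iL: "i \<notin> L" "i \<noteq> z" "i \<in> V" using i by (auto simp: R_def)
    have "2 \<le> k" using some_edge k_ge_2 by blast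
    moreover have "card (f ` V) \<le> card {0, 1 :: nat}" by (intro card_mono) (auto simp: f_def)
    ultimately have opt: "opt f"
      using L iL adj_iff by (auto simp: opt_def proper_iff f_def)
    \<comment> \<open>The only two vertices of color 0 become the leaves \<open>a\<close> and
      \<open>b\<close>, so the edge \<open>z c\<close> is monochromatic. Its repair exchanges
      \<open>z\<close> or \<open>c\<close> with \<open>a\<close> or \<open>b\<close>. If
      \<open>z\<close> moves, it matches the other one of \<open>a\<close> and \<open>b\<close>; if
      \<open>c\<close> moves, the exchanged leaf takes the color of \<open>z\<close>.\<close>
    have d: "distinct [a, b, z, c, i]" "distinct [z, i, a, b, c]" using l L iL by auto
    obtain \<sigma> u v where s: "bij_betw \<sigma> V V" "map \<sigma> [a, b, z, c, i] = [z, i, a, b, c]" "u \<in> V" "v \<in> V"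
      "\<forall>x y. adj x y \<longrightarrow> f (\<sigma> (transpose u v x)) \<noteq> f (\<sigma> (transpose u v y))"
      by (rule swap_extension[OF opt d]) (use l L iL zV in auto)
    have f0: "f (\<sigma> x) = 0 \<longleftrightarrow> x \<in> {a, b}" if "x \<in> V" for x
      using s(1,2) that l L zV unfolding bij_betw_def f_def by (auto dest: inj_onD)
    have f1: "f x = 0 \<or> f x = 1" for x by (simp add: f_def)
    have ad: "adj z a" "adj z b" "adj z c" using l adj_iff by auto
    have m: "z \<in> {u, v} \<longleftrightarrow> c \<notin> {u, v}" "f (\<sigma> u) \<noteq> f (\<sigma> v)"
      using monochromatic_edge[of "\<lambda>x. f (\<sigma> x)", OF s(5) ad(3)] s(2) d by (auto simp: f_def)
    have fz: "f (\<sigma> z) = 1" "f (\<sigma> c) = 1" using s(2) d by (auto simp: f_def)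
    have w: "u \<in> {a, b} \<and> f (\<sigma> v) = 1 \<or> v \<in> {a, b} \<and> f (\<sigma> u) = 1"
      using m(2) f0[OF s(3)] f0[OF s(4)] f1 by metis
    have "a \<in> V" "b \<in> V" using l L by auto
    then have False
      using w m(1) fz f0[of a] f0[of b] l L d s(5)[rule_format, OF ad(1)] s(5)[rule_format, OF ad(2)]
      by (auto simp: transpose_def split: if_splits)
    then show ?thesis ..
  qed
qed

text \<open>Pairwise intersecting edges form a star or a triangle. Four equal colors force the edges
  to intersect pairwise and exclude the triangle.\<close>

lemma class_of_four_listed:
  assumes f: "opt f" and c: "card {v \<in> V. f v = i} \<ge> 4"
  shows "listed G"
proof -
  obtain y1 y2 y3 y4 where y: "{y1, y2, y3, y4} \<subseteq> {v \<in> V. f v = i}" "distinct [y1, y2, y3, y4]"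
    using four_of_card[OF c] .
  have no2: "\<not> (adj a b \<and> adj c d \<and> distinct [a, b, c, d])" for a b c d
    using four_alike[OF f y(2)] y(1) by auto
  have no3: "\<not> (adj a b \<and> adj b c \<and> adj c a)" for a b c
    using three_alike[OF f, of y1 y2 y3] y by auto
  obtain a b where ab: "adj a b" using some_edge by blast
  show ?thesis
  proof (cases "\<forall>u v. adj u v \<longrightarrow> u = a \<or> v = a")
    case True then show ?thesis using star_listed by blast
  next
    case False
    then obtain c d where cd: "adj c d" "c \<noteq> a" "d \<noteq> a" by blast
    have "\<exists>c. adj b c \<and> c \<noteq> a"
      using no2[of a b c d] ab cd adj_V[OF cd(1)] adj_V[OF ab] adj_sym by auto
    then obtain e where e: "adj b e" "e \<noteq> a" by blast
    have "u = b \<or> v = b" if uv: "adj u v" for u v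
    proof (rule ccontr)
      assume n: "\<not> ?thesis"
      then have "u = a \<or> v = a"
        using no2[of a b u v] ab uv adj_V[OF uv] adj_V[OF ab] by auto
      then obtain w where w: "adj a w" "w \<noteq> b" using uv n adj_sym by blast
      show False
      proof (cases "w = e")
        case True then show False using no3[of a b e] ab e w adj_sym by blast
      next
        case False then show False
          using no2[of a w b e] e w adj_V[OF e(1)] adj_V[OF w(1)] adj_V[OF ab] by auto
      qed
    qed
    then show ?thesis using star_listed by blast
  qed
qed

text \<open>The color of \<open>a1\<close>, \<open>a2\<close> is moved to \<open>b1\<close>,
  \<open>b2\<close>. The first alternative collects the repairs after which \<open>a1\<close> and
  \<open>a2\<close> still have equal colors; the other four correspond to exchanging one of
  \<open>b1\<close>, \<open>b2\<close> with one of \<open>a1\<close>, \<open>a2\<close>.\<close>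

lemma two_three_swap:
  assumes V: "V = {a1, a2, b1, b2, b3}" and d: "distinct [a1, a2, b1, b2, b3]" and k: "k = 2"
    and ind: "\<not> adj a1 a2" "\<not> adj b1 b2" "\<not> adj b1 b3" "\<not> adj b2 b3"
  shows "(\<exists>b\<in>{b1, b2, b3}. \<not> adj a1 b \<and> \<not> adj a2 b)
    \<or> \<not> adj a1 b1 \<and> \<not> adj a2 b2 \<and> \<not> adj a2 b3
    \<or> \<not> adj a2 b1 \<and> \<not> adj a1 b2 \<and> \<not> adj a1 b3
    \<or> \<not> adj a1 b2 \<and> \<not> adj a2 b1 \<and> \<not> adj a2 b3
    \<or> \<not> adj a2 b2 \<and> \<not> adj a1 b1 \<and> \<not> adj a1 b3"
proof -
  define f where "f x = (if x \<in> {a1, a2} then 0 else 1 :: nat)" for x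
  have "card (f ` V) \<le> card {0, 1 :: nat}" by (intro card_mono) (auto simp: f_def)
  moreover have "f x \<noteq> f y" if "adj x y" for x y
    using that adj_V[OF that] ind adj_sym unfolding V f_def by auto
  ultimately have opt: "opt f"
    by (simp add: opt_def proper_iff k)
  have d': "distinct [b1, b2, a1, a2, b3]" using d by auto
  obtain \<sigma> u v where s: "map \<sigma> [b1, b2, a1, a2, b3] = [a1, a2, b1, b2, b3]" "u \<in> V" "v \<in> V"
    "\<forall>x y. adj x y \<longrightarrow> f (\<sigma> (transpose u v x)) \<noteq> f (\<sigma> (transpose u v y))"
    by (rule swap_extension[OF opt d' d]) (use V in auto)
  define c where "c x = (if x \<in> {b1, b2} then 0 else 1 :: nat)" for x
  have "f (\<sigma> x) = c x" if "x \<in> V" for x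
    using s(1) d that unfolding V by (auto simp: f_def c_def)
  moreover have "transpose u v x \<in> V" if "x \<in> V" for x
    using s(2,3) that by (auto simp: transpose_def)
  ultimately have sw: "c (transpose u v x) \<noteq> c (transpose u v y)" if "adj x y" for x y
    using s(4) adj_V[OF that] that by metis
  have sw': "c (transpose u v a) = c (transpose u v b) \<Longrightarrow> \<not> adj a b" for a b
    using sw by blast
  have uv: "u \<in> {a1, a2, b1, b2, b3}" "v \<in> {a1, a2, b1, b2, b3}" using s(2,3) V by auto
  have c0: "c b1 = 0" "c b2 = 0" "c a1 = 1" "c a2 = 1" "c b3 = 1" using d by (auto simp: c_def)
  have ne: "a1 \<noteq> a2" "a1 \<noteq> b1" "a1 \<noteq> b2" "a1 \<noteq> b3" "a2 \<noteq> a1"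
    "a2 \<noteq> b1" "a2 \<noteq> b2" "a2 \<noteq> b3" "b1 \<noteq> a1" "b1 \<noteq> a2"
    "b1 \<noteq> b2" "b1 \<noteq> b3" "b2 \<noteq> a1" "b2 \<noteq> a2" "b2 \<noteq> b1"
    "b2 \<noteq> b3" "b3 \<noteq> a1" "b3 \<noteq> a2" "b3 \<noteq> b1" "b3 \<noteq> b2"
    using d by auto
  \<comment> \<open>One pattern for the unchanged coloring, and six for exchanging one of two zeros
    with one of three ones.\<close>
  have "map (\<lambda>x. c (transpose u v x)) [a1, a2, b1, b2, b3] \<in>
    {[1,1,0,0,1], [0,1,1,0,1], [0,1,0,1,1], [1,0,1,0,1], [1,0,0,1,1], [1,1,1,0,0], [1,1,0,1,0]}"
    using uv by (elim insertE emptyE) (simp_all add: transpose_def c0 ne)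
  then show ?thesis
    using sw'[of a1 b1] sw'[of a1 b2] sw'[of a1 b3] sw'[of a2 b1] sw'[of a2 b2] sw'[of a2 b3]
    by (elim insertE emptyE) simp_all
qed

text \<open>Suppose each \<open>b\<close> has a neighbor among \<open>a1\<close>, \<open>a2\<close>.
  Then one \<open>b\<close> misses only one of them and the other two \<open>b\<close>'s miss only
  the other one, with the single \<open>b\<close> in the chosen pair. The single \<open>b\<close> is
  determined by the graph, so choosing the pair without it gives a contradiction.\<close>

lemma two_three_isolated:
  assumes V: "V = {a1, a2, b1, b2, b3}" and d: "distinct [a1, a2, b1, b2, b3]" and k: "k = 2"
    and ind: "\<not> adj a1 a2" "\<not> adj b1 b2" "\<not> adj b1 b3" "\<not> adj b2 b3"
  shows "\<exists>b\<in>{b1, b2, b3}. \<forall>u. \<not> adj u b"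
proof -
  have "\<exists>b\<in>{b1, b2, b3}. \<not> adj a1 b \<and> \<not> adj a2 b"
  proof -
    have V': "V = {a1, a2, b1, b3, b2}" "V = {a1, a2, b2, b3, b1}" using V by auto
    show ?thesis
      using two_three_swap[OF V _ k] two_three_swap[OF V'(1) _ k] two_three_swap[OF V'(2) _ k] d ind adj_sym
      by (simp, blast)
  qed
  moreover have "u \<in> {a1, a2}" if "adj u b" "b \<in> {b1, b2, b3}" for u b
    using that adj_V[OF that(1)] ind adj_sym unfolding V by auto
  ultimately show ?thesis by blast
qed

end

section \<open>Two colors\<close>

context villainy_two
begin

lemma two_colorable_listed:
  assumes k: "k = 2"
  shows "listed G"
proof (rule ccontr)
  assume nl: "\<not> listed G"
  define bp where "bp A B \<longleftrightarrow> A \<union> B = V \<and> A \<inter> B = {} \<and>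
    (\<forall>u\<in>A. \<forall>v\<in>A. \<not> adj u v) \<and> (\<forall>u\<in>B. \<forall>v\<in>B. \<not> adj u v)" for A B
  have bp_sym: "bp B A" if "bp A B" for A B
    using that unfolding bp_def by blast
  have bp_finite: "finite A" "finite B" if "bp A B" for A B
    using that finite_V unfolding bp_def by (metis finite_Un)+
  have bp_le: "card A \<le> 3" if "bp A B" for A B
  proof (rule ccontr)
    assume 4: "\<not> card A \<le> 3"
    define f where "f v = (if v \<in> A then 0 else 1 :: nat)" for v
    have "card (f ` V) \<le> card {0, 1 :: nat}" by (intro card_mono) (auto simp: f_def)
    moreover have "f u \<noteq> f v" if "adj u v" for u v
      using adj_V[OF that] that \<open>bp A B\<close> unfolding bp_def f_def by (metis UnE zero_neq_one)
    ultimately have "opt f" by (simp add: opt_def proper_iff k)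
    moreover have "{v \<in> V. f v = 0} = A" using that by (auto simp: bp_def f_def)
    ultimately show False using class_of_four_listed[of f 0] nl 4 by simp
  qed
  have bp_ge: "2 \<le> card A" if "bp A B" for A B
  proof (rule ccontr)
    assume "\<not> 2 \<le> card A"
    then have one: "\<forall>x\<in>A. \<forall>y\<in>A. x = y"
      using card_le_Suc0_iff_eq[OF bp_finite(1)[OF that]] by linarith
    obtain z where z: "A \<subseteq> {z}"
      using one by (cases "A = {}") blast+
    have "u = z \<or> v = z" if "adj u v" for u v
      using adj_V[OF that] that \<open>bp A B\<close> z unfolding bp_def by blast
    then show False using star_listed nl by blast
  qed
  \<comment> \<open>A set closed under adjacency is a union of components, and on it the two sides
    may be interchanged.\<close>
  have flip: "bp ((A - C) \<union> (B \<inter> C)) ((B - C) \<union> (A \<inter> C))"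
    if "bp A B" "C \<subseteq> V" "\<And>u v. adj u v \<Longrightarrow> u \<in> C \<longleftrightarrow> v \<in> C" for A B C
    using that unfolding bp_def by blast
  have move: "bp (A - {x}) (insert x B)" if that: "bp A B" "x \<in> A" "\<And>u. \<not> adj u x" for A B x
  proof -
    have "u \<in> {x} \<longleftrightarrow> v \<in> {x}" if "adj u v" for u v
      using that \<open>\<And>u. \<not> adj u x\<close> adj_sym by blast
    moreover have "{x} \<subseteq> V" using that by (auto simp: bp_def)
    ultimately have "bp ((A - {x}) \<union> (B \<inter> {x})) ((B - {x}) \<union> (A \<inter> {x}))"
      by (intro flip[OF that(1)]) blast+
    moreover have "(A - {x}) \<union> (B \<inter> {x}) = A - {x}" "(B - {x}) \<union> (A \<inter> {x}) = insert x B"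
      using that unfolding bp_def by auto
    ultimately show ?thesis by simp
  qed
  \<comment> \<open>Moving an isolated vertex to the other side would leave a side with a single
    vertex.\<close>
  have small_nonisolated: "\<exists>u. adj u x" if "bp A B" "card A = 2" "x \<in> A" for A B x
    using bp_ge[OF move[OF that(1,3)]] that bp_finite[OF that(1)] by force
  obtain f where f: "opt f" using opt_exists by blast
  then obtain i j where ij: "f ` V = {i, j}" "i \<noteq> j"
    using opt_card[OF f] k card_2_obtain by metis
  have "bp {v \<in> V. f v = i} {v \<in> V. f v = j}"
    using ij opt_proper[OF f] unfolding bp_def by fastforce
  then obtain A B where AB: "bp A B" "card A \<le> card B"
    using bp_sym by (meson nat_le_linear)
  have V: "V = A \<union> B" and disj: "A \<inter> B = {}" and
    ind: "\<And>u v. u \<in> A \<Longrightarrow> v \<in> A \<Longrightarrow> \<not> adj u v" "\<And>u v. u \<in> B \<Longrightarrow> v \<in> B \<Longrightarrow> \<not> adj u v"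
    using AB(1) by (auto simp: bp_def)
  note fin = bp_finite[OF AB(1)]
  have inc: "\<exists>y\<in>V. adj x y \<and> x \<noteq> y" if "adj u x" for u x
    using that adj_V adj_sym by metis
  consider (22) "card A = 2" "card B = 2" | (23) "card A = 2" "card B = 3" | (33) "card A = 3" "card B = 3"
    using bp_ge[OF AB(1)] bp_le[OF AB(1)] bp_le[OF bp_sym[OF AB(1)]] AB(2) by linarith
  then show False
  proof cases
    case 22
    obtain a1 a2 where A: "A = {a1, a2}" "a1 \<noteq> a2" using 22 card_2_obtain by metis
    obtain b1 b2 where B: "B = {b1, b2}" "b1 \<noteq> b2" using 22 card_2_obtain by metis
    have ni: "\<exists>y\<in>V. adj x y \<and> x \<noteq> y" if "x \<in> V" for x
      using that small_nonisolated[OF AB(1) 22(1)] small_nonisolated[OF bp_sym[OF AB(1)] 22(2)] inc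
      unfolding V by blast
    have d: "distinct [a1, a2, b1, b2]" using A B disj by auto
    have nb: "adj a1 b1 \<or> adj a1 b2" "adj a2 b1 \<or> adj a2 b2" "adj a1 b1 \<or> adj a2 b1" "adj a1 b2 \<or> adj a2 b2"
      using ni[of a1] ni[of a2] ni[of b1] ni[of b2] ind 
      unfolding V A B by (auto simp: adj_sym)
    have ni2: "\<not> adj a1 a2" "\<not> adj b1 b2" using ind A B by auto
    obtain w x y z where w: "{w, x, y, z} = {a1, a2, b1, b2}" "distinct [w, x, y, z]"
      "adj w x" "adj y z" "\<not> adj w y" "\<not> adj x z" "adj w z \<longrightarrow> adj x y"
      using four_vertices[OF d ni2 nb] by metis
    have "V = {w, x, y, z}" unfolding w(1) V A B by auto
    then show False using listed_four(1)[OF w(2) _ w(3-7)] nl by blast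
  next
    case 23
    obtain a1 a2 where A: "A = {a1, a2}" "a1 \<noteq> a2" using 23 card_2_obtain by metis
    obtain c1 c2 c3 where C: "B = {c1, c2, c3}" "distinct [c1, c2, c3]" using 23 card_3_obtain by metis
    have "\<exists>b\<in>{c1, c2, c3}. \<forall>u. \<not> adj u b"
      using A C disj ind V by (intro two_three_isolated[OF _ _ k, of a1 a2]) auto
    then obtain b where b: "b \<in> B" "\<And>u. \<not> adj u b" using C by auto
    have cB: "card (B - {b}) = 2" using b 23 fin by simp
    then obtain b1 b2 where B: "B - {b} = {b1, b2}" "b1 \<noteq> b2" using card_2_obtain by metis
    \<comment> \<open>After moving \<open>b\<close> the sides again have sizes two and three, but
      now the two remaining vertices of \<open>B\<close> form the small side. So no vertex other
      than \<open>b\<close> is isolated.\<close>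
    have bp': "bp (B - {b}) (insert b A)" using move[OF bp_sym[OF AB(1)] b] .
    have ni: "\<exists>y\<in>V. adj x y \<and> x \<noteq> y" if "x \<in> V" "x \<noteq> b" for x
      using that small_nonisolated[OF AB(1) 23(1)] small_nonisolated[OF bp' cB] inc
      unfolding V by blast
    have BB: "B = {b, b1, b2}" using B b by auto
    have d: "distinct [a1, a2, b1, b2]" "b \<notin> {a1, a2, b1, b2}" using A B BB disj by auto
    have nb: "adj a1 b1 \<or> adj a1 b2" "adj a2 b1 \<or> adj a2 b2" "adj a1 b1 \<or> adj a2 b1" "adj a1 b2 \<or> adj a2 b2"
      using ni[of a1] ni[of a2] ni[of b1] ni[of b2] ind b(2) d(2)
      unfolding V A BB by (auto simp: adj_sym)
    have ni2: "\<not> adj a1 a2" "\<not> adj b1 b2" using ind A BB by auto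
    obtain w x y z where w: "{w, x, y, z} = {a1, a2, b1, b2}" "distinct [w, x, y, z]"
      "adj w x" "adj y z" "\<not> adj w y" "\<not> adj x z" "adj w z \<longrightarrow> adj x y"
      using four_vertices[OF d(1) ni2 nb] by metis
    have "V = insert b {w, x, y, z}" unfolding w(1) V A BB by auto
    then show False using listed_four(2)[OF w(2) _ w(3-7), of b] nl d(2) w(1) b(2)
      by (simp add: insert_commute)
  next
    case 33
    \<comment> \<open>With both sides of size three, interchanging sides on an unbalanced union of
      components would create a side with more than three vertices.\<close>
    have bal: "card (A \<inter> C) = card (B \<inter> C)"
      if "C \<subseteq> V" "\<And>u v. adj u v \<Longrightarrow> u \<in> C \<longleftrightarrow> v \<in> C" for C
    proof -
      have cA: "card (A - C) + card (A \<inter> C) = 3" and cB: "card (B - C) + card (B \<inter> C) = 3"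
        using 33 fin by (metis card_Diff_subset_Int card_Int_Diff add.commute)+
      have "bp ((A - C) \<union> (B \<inter> C)) ((B - C) \<union> (A \<inter> C))" using flip[OF AB(1) that] .
      then have "card ((A - C) \<union> (B \<inter> C)) \<le> 3" "card ((B - C) \<union> (A \<inter> C)) \<le> 3"
        using bp_le bp_sym by blast+
      moreover have "card ((A - C) \<union> (B \<inter> C)) = card (A - C) + card (B \<inter> C)"
        "card ((B - C) \<union> (A \<inter> C)) = card (B - C) + card (A \<inter> C)"
        using fin disj by (auto intro!: card_Un_disjoint)
      ultimately show ?thesis using cA cB by linarith
    qed
    have "bipartition G A B"
      unfolding bipartition_def
    proof (intro conjI ballI)
      fix e assume e: "e \<in> edges G"
      then have "card e = 2" "e \<subseteq> V" using simple by (auto simp: simple_graph_def)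
      then obtain u v where "e = {u, v}" using card_2_obtain by metis
      then show "\<exists>x\<in>A. \<exists>y\<in>B. e = {x, y}"
        using e \<open>e \<subseteq> V\<close> ind unfolding V adj_def by (auto simp: insert_commute)
    qed (use V disj in auto)
    moreover have "card V = 6" using 33 fin disj V by (simp add: card_Un_disjoint)
    ultimately have "\<not> connected_graph G" using nl 33 unfolding listed_def by blast
    then obtain u v where uv: "u \<in> V" "v \<in> V" "(u, v) \<notin> {(x, y). adj x y}\<^sup>*"
      using V_nonempty unfolding connected_graph_def adj_def by blast
    define D where "D = {x \<in> V. (u, x) \<in> {(x, y). adj x y}\<^sup>*}"
    have D: "D \<subseteq> V" "u \<in> D" "v \<notin> D" using uv by (auto simp: D_def)
    have Dc: "x \<in> D \<longleftrightarrow> y \<in> D" if "adj x y" for x y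
      using that adj_V[OF that] adj_sym unfolding D_def by (auto intro: rtrancl_into_rtrancl)
    have cl: "card (A \<inter> D) + card (A \<inter> (V - D)) = 3"
    proof -
      have "A \<inter> (V - D) = A - D" using V by auto
      then show ?thesis using card_Int_Diff[OF fin(1), of D] 33 by simp
    qed
    have nz: "card (A \<inter> C) \<noteq> 0" if "C \<subseteq> V" "\<And>u v. adj u v \<Longrightarrow> u \<in> C \<longleftrightarrow> v \<in> C" "C \<noteq> {}" for C
    proof
      assume "card (A \<inter> C) = 0"
      then have "A \<inter> C = {}" "B \<inter> C = {}" using bal[OF that(1,2)] fin by auto
      then show False using that V by auto
    qed
    \<comment> \<open>The component \<open>D\<close> and its complement share the three vertices of
      \<open>A\<close>, and by balance neither gets none. The part with one vertex of
      \<open>A\<close> also has just one of \<open>B\<close> and turns out to be an edge.\<close>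
    have "card (A \<inter> D) = 1 \<or> card (A \<inter> (V - D)) = 1"
      using cl nz[of D] nz[of "V - D"] D Dc uv adj_V by fastforce
    then obtain C where C: "C \<subseteq> V" "\<And>u v. adj u v \<Longrightarrow> u \<in> C \<longleftrightarrow> v \<in> C" "card (A \<inter> C) = 1"
      using D Dc adj_V by (metis DiffD1 DiffD2 DiffI Diff_subset)
    then obtain a b where ab: "A \<inter> C = {a}" "B \<inter> C = {b}"
      using bal[OF C(1,2)] by (metis card_1_singletonE)
    have Ceq: "C = {a, b}" using ab C(1) V by auto
    have ni: "\<exists>y\<in>V. adj x y \<and> x \<noteq> y" if "x \<in> V" for x
    proof (rule ccontr)
      assume n: "\<not> ?thesis"
      have "\<not> adj x y" "\<not> adj y x" for y
        using n adj_V[of x y] adj_V[of y x] adj_sym[of x y] by blast+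
      then have "card (A \<inter> {x}) = card (B \<inter> {x})"
        using that by (intro bal) auto
      then show False using that V disj by (auto simp: Int_insert_right split: if_splits)
    qed
    have abn: "a \<in> A" "b \<in> B" "a \<noteq> b" using ab disj by auto
    have "adj a b" using ni[of a] C(2)[of a] abn V Ceq by auto
    have cAB: "card (A - {a}) = 2" "card (B - {b}) = 2" using abn 33 fin by auto
    obtain a1 a2 where A': "A - {a} = {a1, a2}" "a1 \<noteq> a2" using cAB card_2_obtain by metis
    obtain b1 b2 where B': "B - {b} = {b1, b2}" "b1 \<noteq> b2" using cAB card_2_obtain by metis
    have A: "A = {a, a1, a2}" and B: "B = {b, b1, b2}" using A' B' abn by auto
    have d: "distinct [a1, a2, b1, b2]" "a \<notin> {a1, a2, b1, b2}" "b \<notin> {a1, a2, b1, b2}"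
      using A' B' A B disj by auto
    have cut: "\<forall>u\<in>{a1, a2, b1, b2}. \<not> adj u a \<and> \<not> adj u b"
      using C(2) d Ceq by blast
    have nb: "adj a1 b1 \<or> adj a1 b2" "adj a2 b1 \<or> adj a2 b2" "adj a1 b1 \<or> adj a2 b1" "adj a1 b2 \<or> adj a2 b2"
      using ni[of a1] ni[of a2] ni[of b1] ni[of b2] ind cut
      unfolding V A B by (auto simp: adj_sym)
    have ni2: "\<not> adj a1 a2" "\<not> adj b1 b2" using ind A B by auto
    obtain w x y z where w: "{w, x, y, z} = {a1, a2, b1, b2}" "distinct [w, x, y, z]"
      "adj w x" "adj y z" "\<not> adj w y" "\<not> adj x z" "adj w z \<longrightarrow> adj x y"
      using four_vertices[OF d(1) ni2 nb] by metis
    have V6: "V = {w, x, y, z} \<union> {a, b}" unfolding w(1) V A B by auto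
    have "distinct [w, x, y, z, a, b]" using w(1,2) d abn by auto
    then show False
      using listed_four(3)[OF w(2) _ w(3-7), of a b] V6 nl \<open>adj a b\<close> cut unfolding w(1)[symmetric]
      by (simp add: insert_commute)
  qed
qed

end

section \<open>At least three colors\<close>

lemma two_of_card:
  assumes "2 \<le> card A"
  obtains a b where "{a, b} \<subseteq> A" "a \<noteq> b"
  using assms by (metis card_2_obtain obtain_subset_with_card_n)

lemma card_le_fibres:
  assumes "finite A" "\<And>i. card {v \<in> A. f v = i} \<le> m"
  shows "card A \<le> card (f ` A) * m"
proof -
  have "card A = card (\<Union>i\<in>f ` A. {v \<in> A. f v = i})"
    by (rule arg_cong[where f = card]) auto
  also have "\<dots> \<le> (\<Sum>i\<in>f ` A. card {v \<in> A. f v = i})"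
    using assms(1) by (intro card_UN_le) auto
  also have "\<dots> \<le> card (f ` A) * m"
    using assms(2) sum_bounded_above[of "f ` A" "\<lambda>i. card {v \<in> A. f v = i}" m] by auto
  finally show ?thesis .
qed

section \<open>Modifying optimal colorings; odd structure of triangle-free graphs\<close>

context fin_graph
begin

lemma fewer_colors_False:
  assumes "opt f" "proper_coloring G g" "g ` V \<subseteq> f ` V - {c}" "c \<in> f ` V"
  shows False
proof -
  have "card (g ` V) \<le> card (f ` V - {c})" using assms(3) by (intro card_mono) auto
  also have "\<dots> < card (f ` V)" using assms(4) by (intro psubset_card_mono) auto
  finally show False using chromatic_number_le[OF assms(2)] assms(1) by (simp add: opt_def)
qed

lemma move_opt:
  assumes "opt f" "y \<in> V" "\<And>v. f v = f y \<Longrightarrow> \<not> adj x v"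
  shows "opt (f(x := f y))"
proof -
  have "(f(x := f y)) ` V \<subseteq> f ` V" using assms(2) by auto
  then have "card ((f(x := f y)) ` V) \<le> card (f ` V)" by (intro card_mono) auto
  moreover have "(f(x := f y)) u \<noteq> (f(x := f y)) v" if "adj u v" for u v
    using assms(3) that opt_proper[OF assms(1) that] adj_sym adj_V(3)[OF that] by (metis fun_upd_apply)
  ultimately show ?thesis using assms(1) by (simp add: opt_def proper_iff)
qed

text \<open>Otherwise \<open>s\<close> could join the class of \<open>t\<close> and its own color
  would disappear.\<close>

lemma singleton_class_adjacent:
  assumes f: "opt f" and s: "s \<in> V" "\<And>v. v \<in> V \<Longrightarrow> f v = f s \<Longrightarrow> v = s" and t: "t \<in> V" "t \<noteq> s"
  shows "\<exists>t'. f t' = f t \<and> adj s t'"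
proof (rule ccontr)
  assume n: "\<not> ?thesis"
  then have "opt (f(s := f t))" using move_opt[OF f t(1)] by blast
  moreover have "(f(s := f t)) ` V \<subseteq> f ` V - {f s}" using s t by auto
  ultimately show False using fewer_colors_False[OF f, of "f(s := f t)" "f s"] s(1) by (simp add: opt_def)
qed

text \<open>Otherwise the two classes could be merged, saving a color.\<close>

lemma classes_adjacent:
  assumes f: "opt f" and xy: "x \<in> V" "y \<in> V" "f x \<noteq> f y"
  shows "\<exists>x' y'. f x' = f x \<and> f y' = f y \<and> adj x' y'"
proof (rule ccontr)
  assume n: "\<not> ?thesis"
  let ?g = "\<lambda>v. if f v = f x then f y else f v"
  have "?g u \<noteq> ?g v" if "adj u v" for u v
    using n that opt_proper[OF f that] adj_sym by auto
  then have "proper_coloring G ?g" by (simp add: proper_iff)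
  moreover have "?g ` V \<subseteq> f ` V - {f x}" using xy by auto
  ultimately show False using fewer_colors_False[OF f] xy by blast
qed

lemma other_color:
  assumes "opt f" "finite S" "card S < k"
  shows "\<exists>b\<in>V. f b \<notin> S"
proof (rule ccontr)
  assume "\<not> ?thesis"
  then have "f ` V \<subseteq> S" by auto
  from card_mono[OF assms(2) this] show False using opt_card[OF assms(1)] assms(3) by simp
qed

lemma pigeonhole_pair:
  assumes "opt f" "A \<subseteq> V" "k < card A"
  shows "\<exists>y\<in>A. \<exists>y'\<in>A. y \<noteq> y' \<and> f y = f y'"
proof -
  have "card (f ` A) \<le> card (f ` V)" using assms(2) by (intro card_mono image_mono) auto
  then have "\<not> inj_on f A" using assms card_image[of f A] by (auto simp: opt_def)
  then show ?thesis by (auto simp: inj_on_def)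
qed

definition triangle_free :: bool where
  "triangle_free \<longleftrightarrow> (\<forall>a b c. \<not> (adj a b \<and> adj b c \<and> adj c a))"

definition bipartite_on :: "'a set \<Rightarrow> bool" where
  "bipartite_on W \<longleftrightarrow> (\<exists>A. \<forall>u\<in>W. \<forall>v\<in>W. adj u v \<longrightarrow> (u \<in> A \<longleftrightarrow> v \<notin> A))"

lemma bipartite_on_V:
  assumes "bipartite_on V"
  shows "k \<le> 2"
proof -
  obtain A where A: "\<forall>u\<in>V. \<forall>v\<in>V. adj u v \<longrightarrow> (u \<in> A \<longleftrightarrow> v \<notin> A)"
    using assms unfolding bipartite_on_def by blast
  let ?f = "\<lambda>v. if v \<in> A then 0 else 1 :: nat"
  have "proper_coloring G ?f" using A adj_V(1,2) unfolding proper_iff by (metis zero_neq_one)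
  then have "k \<le> card (?f ` V)" by (rule chromatic_number_le)
  also have "\<dots> \<le> card {0, 1 :: nat}" by (intro card_mono) auto
  finally show ?thesis by simp
qed

lemma triangle_free_one_singleton:
  assumes tf: triangle_free and f: "opt f" and k: "3 \<le> k"
    and s: "s \<in> V" "\<And>v. v \<in> V \<Longrightarrow> f v = f s \<Longrightarrow> v = s"
    and t: "t \<in> V" "\<And>v. v \<in> V \<Longrightarrow> f v = f t \<Longrightarrow> v = t"
  shows "s = t"
proof (rule ccontr)
  assume st: "s \<noteq> t"
  obtain t' where "f t' = f t" "adj s t'" using singleton_class_adjacent[OF f s t(1)] st by blast
  then have ast: "adj s t" using t(2) adj_V by metis
  have "card {f s, f t} < k" using k card_insert_le_m1[of 2 "{f t}" "f s"] by (simp add: card_insert_if)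
  then obtain r where r: "r \<in> V" "f r \<noteq> f s" "f r \<noteq> f t" using other_color[OF f, of "{f s, f t}"] by auto
  \<comment> \<open>The neighbourhood of \<open>s\<close> is independent, so it can take the colour of \<open>t\<close>; then \<open>s\<close> may join any third class.\<close>
  define g where "g v = (if adj s v then f t else if v = s then f r else f v)" for v
  have "g u \<noteq> g v" if uv: "adj u v" for u v
  proof -
    have "\<not> (adj s u \<and> adj s v)" using tf uv adj_sym unfolding triangle_free_def by blast
    then show ?thesis
      using uv opt_proper[OF f uv] adj_V[OF uv] t(2) ast r adj_sym unfolding g_def by metis
  qed
  then have "proper_coloring G g" by (simp add: proper_iff)
  moreover have "g ` V \<subseteq> f ` V - {f s}"
    using r t(1) s st unfolding g_def by auto
  ultimately show False using fewer_colors_False[OF f] s(1) by blast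
qed

text \<open>A chord of a closed walk of length five cuts off a triangle, and a repeated vertex
  produces such a chord. So excluding closed walks is the same as excluding 5-cycles.\<close>

lemma triangle_free_5_cycle_distinct:
  assumes triangle_free "adj a b" "adj b c" "adj c d" "adj d e" "adj e a"
  shows "distinct [a, b, c, d, e]" "\<not> adj a c" "\<not> adj a d" "\<not> adj b d" "\<not> adj b e" "\<not> adj c e"
proof -
  show n: "\<not> adj a c" "\<not> adj a d" "\<not> adj b d" "\<not> adj b e" "\<not> adj c e"
    using assms adj_sym unfolding triangle_free_def by blast+
  have "a \<noteq> b" "b \<noteq> c" "c \<noteq> d" "d \<noteq> e" "e \<noteq> a" using assms adj_V(3) by blast+
  moreover have "a \<noteq> c" "a \<noteq> d" "b \<noteq> d" "b \<noteq> e" "c \<noteq> e" using assms n adj_sym by blast+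
  ultimately show "distinct [a, b, c, d, e]" by auto
qed

text \<open>A vertex-minimal non-bipartite set is explored by breadth-first layers around one of its vertices.\<close>

lemma five_cycle_or_three_matching:
  assumes tf: triangle_free and k: "3 \<le> k"
  shows "(\<exists>a b c d e. adj a b \<and> adj b c \<and> adj c d \<and> adj d e \<and> adj e a) \<or>
    (7 \<le> card V \<and> (\<exists>a a' b b' c c'. adj a a' \<and> adj b b' \<and> adj c c' \<and> distinct [a, a', b, b', c, c']))"
proof (cases "\<exists>a b c d e. adj a b \<and> adj b c \<and> adj c d \<and> adj d e \<and> adj e a")
  case False
  then have no5: "\<not> (adj a b \<and> adj b c \<and> adj c d \<and> adj d e \<and> adj e a)" for a b c d e by blast
  have no3: "\<not> (adj a b \<and> adj b c \<and> adj c a)" for a b c using tf unfolding triangle_free_def by blast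
  have "\<not> bipartite_on V" using bipartite_on_V k by auto
  then obtain W where W': "W \<in> {W \<in> Pow V. \<not> bipartite_on W}"
    and min: "\<And>U. U \<in> {W \<in> Pow V. \<not> bipartite_on W} \<Longrightarrow> U \<subseteq> W \<Longrightarrow> W = U"
    using finite_has_minimal2[of "{W \<in> Pow V. \<not> bipartite_on W}" V] by auto
  have W: "W \<subseteq> V" "\<not> bipartite_on W" using W' by auto
  have minW: "bipartite_on U" if "U \<subset> W" for U using min[of U] that W(1) by blast
  \<comment> \<open>If \<open>y\<close> were the only possible neighbor of \<open>x\<close> in
    \<open>W\<close>, a bipartition of \<open>W - {x}\<close> would extend by placing
    \<open>x\<close> opposite to \<open>y\<close>.\<close>
  have degree2: "\<exists>y'\<in>W. adj x y' \<and> y' \<noteq> y" if xW: "x \<in> W" for x y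
  proof (rule ccontr)
    assume n: "\<not> ?thesis"
    obtain A where A: "\<forall>u\<in>W-{x}. \<forall>v\<in>W-{x}. adj u v \<longrightarrow> (u \<in> A \<longleftrightarrow> v \<notin> A)"
      using minW[of "W - {x}"] xW unfolding bipartite_on_def by blast
    define B where "B = {w. if w = x then y \<notin> A else w \<in> A}"
    have nx: "u = y" if "u \<in> W" "adj x u \<or> adj u x" for u
      using n that adj_sym by blast
    have "u \<in> B \<longleftrightarrow> v \<notin> B" if uv: "u \<in> W" "v \<in> W" "adj u v" for u v
      using A uv nx[of u] nx[of v] adj_V(3)[OF uv(3)] unfolding B_def by (cases "u = x"; cases "v = x") auto
    then show False using W(2) unfolding bipartite_on_def by blast
  qed
  obtain x where x: "x \<in> W" using W(2) unfolding bipartite_on_def by blast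
  define L1 where "L1 = {y \<in> W. adj x y}"
  define L2 where "L2 = {z \<in> W. z \<noteq> x \<and> \<not> adj x z \<and> (\<exists>y\<in>L1. adj y z)}"
  define R where "R = W - {x} - L1 - L2"
  have RL: "\<not> adj v u" "\<not> adj u v" if "u \<in> insert x L1" "v \<in> R" for u v
    using that adj_sym[of u v] unfolding R_def L1_def L2_def by auto
  have L1: "\<not> adj u v" if "u \<in> L1" "v \<in> L1" for u v
    using that no3[of x u v] adj_sym unfolding L1_def by blast
  \<comment> \<open>An edge in the second layer closes a walk of length five through
    \<open>x\<close>.\<close>
  have L2: "\<not> adj u v" if uv: "u \<in> L2" "v \<in> L2" for u v
  proof -
    obtain u' v' where "adj x u'" "adj u' u" "adj x v'" "adj v' v"
      using uv unfolding L2_def L1_def by blast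
    then show ?thesis using no5[of x u' u v v'] adj_sym by blast
  qed
  \<comment> \<open>Without an edge inside \<open>R\<close>, the sets \<open>insert x L2\<close> and
    \<open>L1 \<union> R\<close> would be the two sides of a bipartition of
    \<open>W\<close>.\<close>
  obtain u w where uw: "u \<in> R" "w \<in> R" "adj u w"
  proof (rule ccontr)
    assume n: "\<not> thesis"
    note found = that
    have R: "\<not> adj u v" if "u \<in> R" "v \<in> R" for u v using n found that by blast
    have S: "\<not> adj u v" if "u \<in> insert x L2" "v \<in> insert x L2" for u v
      using that L2[of u v] adj_sym[of u v] unfolding L2_def by auto
    have T: "\<not> adj u v" if "u \<in> L1 \<union> R" "v \<in> L1 \<union> R" for u v
      using that L1 R RL by blast
    have "W \<subseteq> insert x L2 \<union> (L1 \<union> R)" by (auto simp: R_def)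
    then have "\<forall>u\<in>W. \<forall>v\<in>W. adj u v \<longrightarrow> (u \<in> insert x L2 \<longleftrightarrow> v \<notin> insert x L2)"
      using S T by blast
    then show False using W(2) unfolding bipartite_on_def by blast
  qed
  \<comment> \<open>If \<open>L2\<close> is empty, no edge joins \<open>insert x L1\<close> to
    \<open>R\<close>, and a bipartition of the proper subset \<open>R\<close> extends to
    \<open>W\<close>.\<close>
  obtain z where z: "z \<in> L2"
  proof (rule ccontr)
    assume "\<not> thesis"
    then have e: "L2 = {}" using that by blast
    have "R \<subset> W" using x by (auto simp: R_def)
    then obtain A where A: "\<forall>u\<in>R. \<forall>v\<in>R. adj u v \<longrightarrow> (u \<in> A \<longleftrightarrow> v \<notin> A)"
      using minW[of R] unfolding bipartite_on_def by blast
    have S: "\<not> adj u v" if "u \<in> insert x (A \<inter> R)" "v \<in> insert x (A \<inter> R)" for u v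
      using that A RL adj_irrefl by blast
    have T: "\<not> adj u v" if "u \<in> L1 \<union> (R - A)" "v \<in> L1 \<union> (R - A)" for u v
      using that A L1 RL by blast
    have "W \<subseteq> insert x (A \<inter> R) \<union> (L1 \<union> (R - A))" using e by (auto simp: R_def)
    then have "\<forall>u\<in>W. \<forall>v\<in>W. adj u v \<longrightarrow> (u \<in> insert x (A \<inter> R) \<longleftrightarrow> v \<notin> insert x (A \<inter> R))"
      using S T by blast
    then show False using W(2) unfolding bipartite_on_def by blast
  qed
  then obtain y where y: "y \<in> L1" "adj y z" unfolding L2_def by blast
  obtain y' where y': "y' \<in> L1" "y' \<noteq> y" using degree2[OF x, of y] unfolding L1_def by blast
  have inW: "x \<in> W" "y \<in> W" "y' \<in> W" "z \<in> W" "u \<in> W" "w \<in> W"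
    using x y y' z uw by (auto simp: L1_def L2_def R_def)
  have d: "distinct [x, y', y, z, u, w]"
    using y y' z uw adj_V(3)[OF uw(3)] unfolding L1_def L2_def R_def by auto
  \<comment> \<open>If the six chosen vertices were all, the second neighbors of \<open>u\<close>
    and \<open>w\<close> in \<open>W\<close> could only be \<open>z\<close>, giving a triangle. The
    bound 7 is what forces a 5-cycle on fewer vertices, and what later fixes class sizes.\<close>
  have "7 \<le> card V"
  proof (rule ccontr)
    assume "\<not> 7 \<le> card V"
    then have "card V \<le> card (set [x, y', y, z, u, w])" using d by (simp add: distinct_card)
    then have "set [x, y', y, z, u, w] = V"
      using inW W(1) by (intro card_seteq) auto
    then have W6: "W \<subseteq> {x, y', y, z, u, w}" using W(1) by auto
    have nb: "adj v z" if "v \<in> R" "v' \<in> R" "v \<in> {u, w}" "v' \<in> {u, w}" "v \<noteq> v'" for v v'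
    proof -
      have "v \<in> W" using that inW by blast
      then obtain t where t: "t \<in> W" "adj v t" "t \<noteq> v'" using degree2 by blast
      then have "t \<notin> {x, y, y'}" using RL(1)[of t v] that(1) y(1) y'(1) by auto
      moreover have "t \<noteq> v" using adj_V(3)[OF t(2)] by auto
      ultimately show ?thesis using t W6 that by auto
    qed
    have "adj u z" "adj w z" using nb[of u w] nb[of w u] uw adj_V(3)[OF uw(3)] by auto
    then show False using no3[of u w z] uw(3) adj_sym by blast
  qed
  moreover have "adj x y'" using y' by (simp add: L1_def)
  ultimately show ?thesis using y(2) uw(3) d by blast
qed blast

end

section \<open>Excluding classes of size three; graphs with \<open>k + 1\<close> vertices\<close>

context villainy_two
begin

lemma no_class_of_three:
  assumes k: "3 \<le> k" and f: "opt f"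
    and le3: "\<And>g i. opt g \<Longrightarrow> card {v \<in> V. g v = i} \<le> 3"
    and y: "{y1, y2, y3} \<subseteq> V" "distinct [y1, y2, y3]" "f y1 = f y2" "f y2 = f y3"
  shows False
proof -
  have tf: triangle_free
    using three_alike[OF f y(2,1,3,4)] unfolding triangle_free_def by blast
  define single where "single b \<longleftrightarrow> (\<forall>v\<in>V. f v = f b \<longrightarrow> v = b)" for b
  have one: "f b = f c" if "b \<in> V" "c \<in> V" "single b" "single c" for b c
    using triangle_free_one_singleton[OF tf f k that(1) _ that(2)] that(3,4) unfolding single_def by auto
  obtain b0 where b0: "b0 \<in> V" "f b0 \<noteq> f y1"
    using other_color[OF f, of "{f y1}"] k by auto
  have "card {f y1, f b0} < k" using k card_insert_le_m1[of 2 "{f b0}" "f y1"] by simp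
  then obtain c0 where c0: "c0 \<in> V" "f c0 \<noteq> f y1" "f c0 \<noteq> f b0"
    using other_color[OF f, of "{f y1, f b0}"] by auto
  obtain b c where bc: "b \<in> V" "c \<in> V" "f b \<noteq> f y1" "f c \<noteq> f y1" "f b \<noteq> f c" "\<not> single b"
    using one[of b0 c0] b0 c0 by metis
  then obtain b' where b': "b' \<in> V" "f b' = f b" "b' \<noteq> b" unfolding single_def by blast
  have no5: False if C: "adj p q" "adj q r" "adj r s" "adj s t" "adj t p" for p q r s t
    by (rule three_and_two_no_C5[OF f _ y(2) b'(3)[symmetric] y(3,4) b'(2)[symmetric] _ C
          triangle_free_5_cycle_distinct(1)[OF tf C]]) (use y b' bc in auto)
  obtain p p' q q' r r' where m: "7 \<le> card V" "adj p p'" "adj q q'" "adj r r'" "distinct [p, p', q, q', r, r']"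
    using five_cycle_or_three_matching[OF tf k] no5 by blast
  have no_pairs: False if "opt g" "{a1, a1', a2, a2', a3, a3'} \<subseteq> V" "a1 \<noteq> a1'" "a2 \<noteq> a2'" "a3 \<noteq> a3'"
    "g a1 = g a1'" "g a2 = g a2'" "g a3 = g a3'" "g a1 \<noteq> g a2" "g a1 \<noteq> g a3" "g a2 \<noteq> g a3"
    for g a1 a1' a2 a2' a3 a3'
    using three_pairs[OF that m(2-5)] .
  have big_single: "single d" if "d \<in> V" "f d \<noteq> f y1" "f d \<noteq> f b" for d
  proof (rule ccontr)
    assume "\<not> single d"
    then obtain d' where "d' \<in> V" "f d' = f d" "d' \<noteq> d" unfolding single_def by blast
    then show False using no_pairs[OF f, of y1 y2 b b' d d'] y b' bc that by auto
  qed
  have c: "single c" using big_single bc by auto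
  have others: "f v \<in> {f y1, f b, f c}" if "v \<in> V" for v
    using one[of v c] big_single[of v] c bc that by auto
  let ?A = "{v \<in> V. f v = f y1}" and ?B = "{v \<in> V. f v = f b}"
  have "V = ?A \<union> (?B \<union> {c})" using others c bc unfolding single_def by auto
  \<comment> \<open>At least seven vertices lie in two classes of size at most three and one
    singleton, so both large classes have exactly three.\<close>
  then have "card V \<le> card ?A + (card ?B + 1)"
    using card_Un_le[of ?A "?B \<union> {c}"] card_Un_le[of ?B "{c}"] by simp
  then have AB: "card ?A = 3" "card ?B = 3" using m(1) le3[OF f, of "f y1"] le3[OF f, of "f b"] by linarith+
  \<comment> \<open>Moving a non-neighbour of \<open>c\<close> into its class leaves three classes with at least two vertices.\<close>
  have "\<exists>x\<in>V. x \<noteq> c \<and> \<not> adj c x"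
  proof (rule ccontr)
    assume all: "\<not> ?thesis"
    then have "\<forall>u\<in>V. \<forall>v\<in>V. adj u v \<longrightarrow> (u \<in> {c} \<longleftrightarrow> v \<notin> {c})"
      using tf adj_sym adj_V(3) unfolding triangle_free_def by blast
    then have "bipartite_on V" unfolding bipartite_on_def by blast
    then show False using bipartite_on_V k by simp
  qed
  then obtain x where x: "x \<in> V" "x \<noteq> c" "\<not> adj c x" by blast
  define g where "g = f(x := f c)"
  have "\<not> adj x v" if "f v = f c" for v
    using that c x adj_V[of x v] adj_sym unfolding single_def by blast
  then have g: "opt g" unfolding g_def by (intro move_opt[OF f bc(2)])
  have c2: "2 \<le> card (?A - {x})" "2 \<le> card (?B - {x})" using AB by (auto simp: card_Diff_singleton_if)
  obtain a a' where a: "{a, a'} \<subseteq> ?A - {x}" "a \<noteq> a'" using c2(1) by (rule two_of_card)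
  obtain d d' where d: "{d, d'} \<subseteq> ?B - {x}" "d \<noteq> d'" using c2(2) by (rule two_of_card)
  show False
    using no_pairs[OF g, of a a' d d' c x] a d x bc unfolding g_def by auto
qed

text \<open>It remains to bound the degree of \<open>q\<close>. Two neighbors \<open>s\<close>,
  \<open>t\<close> of \<open>q\<close> would be adjacent, and then every other vertex is adjacent to
  both, contrary to \<open>one_pair\<close>.\<close>

lemma complete_minus_vertex_listed:
  assumes k: "3 \<le> k" and n: "card V = k + 1" and f: "opt f"
    and pq: "p \<in> V" "q \<in> V" "p \<noteq> q" "f p = f q"
    and ap: "\<And>s t. s \<in> V \<Longrightarrow> t \<in> V \<Longrightarrow> s \<noteq> t \<Longrightarrow> s \<noteq> q \<Longrightarrow> t \<noteq> q \<Longrightarrow> adj s t"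
  shows "listed G"
proof -
  have "s = t" if st: "adj s q" "adj t q" for s t
  proof (rule ccontr)
    assume "s \<noteq> t"
    then have a: "adj s t" using ap[of s t] adj_V[OF st(1)] adj_V[OF st(2)] by blast
    obtain z where "z \<in> V - {s, t}" "\<not> adj z s \<or> \<not> adj z t"
      using one_pair[OF f _ pq(3,4) a] pq by auto
    then show False
      using ap[of z s] ap[of z t] st adj_sym adj_V[OF st(1)] adj_V[OF st(2)] by (cases "z = q") auto
  qed
  then have "card {u \<in> V. {u, q} \<in> edges G} \<le> Suc 0"
    by (subst card_le_Suc0_iff_eq) (auto simp: adj_def)
  then have "degree G q = 0 \<or> degree G q = 1" unfolding degree_def by linarith
  moreover have "is_complete (delete_vertex G q)"
    using ap unfolding is_complete_def delete_vertex_def adj_def by auto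
  ultimately show ?thesis using pq(2) k n unfolding listed_def by fastforce
qed

lemma one_pair_listed:
  assumes k: "3 \<le> k" and n: "card V = k + 1"
  shows "listed G"
proof -
  obtain f where f: "opt f" using opt_exists by blast
  obtain p q where pq: "p \<in> V" "q \<in> V" "p \<noteq> q" "f p = f q"
    using pigeonhole_pair[OF f order_refl] n by auto
  have "f p \<in> f ` (V - {p})" using pq by auto
  then have "f ` (V - {p}) = f ` V" by auto
  then have inj: "inj_on f (V - {p})"
    using n opt_card[OF f] pq(1) by (intro eq_card_imp_inj_on) auto
  have single: "v = s" if "s \<in> V - {p, q}" "v \<in> V" "f v = f s" for s v
  proof (cases "v = p")
    case True
    then have "q = s" using inj_onD[OF inj, of q s] pq that by auto
    then show ?thesis using that by auto
  next
    case False then show ?thesis using inj_onD[OF inj, of v s] that by auto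
  qed
  have Q: "adj s t" if st: "s \<in> V - {p, q}" "t \<in> V - {p, q}" "s \<noteq> t" for s t
  proof -
    obtain t' where "f t' = f t" "adj s t'"
      using singleton_class_adjacent[OF f, of s t] single[OF st(1)] st by blast
    then show ?thesis using single[OF st(2), of t'] adj_V by metis
  qed
  have Qpq: "adj s p \<or> adj s q" if s: "s \<in> V - {p, q}" for s
  proof -
    obtain t' where t': "f t' = f p" "adj s t'"
      using singleton_class_adjacent[OF f, of s p] single[OF s] s pq by blast
    then have "t' \<in> {p, q}" using inj_onD[OF inj, of t' q] pq adj_V by auto
    then show ?thesis using t' by auto
  qed
  have npq: "\<not> adj p q" using opt_proper[OF f] pq by blast
  have "(\<forall>s\<in>V - {p, q}. adj s p) \<or> (\<forall>s\<in>V - {p, q}. adj s q)"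
  proof (rule ccontr)
    assume "\<not> ?thesis"
    then obtain s t where st: "s \<in> V - {p, q}" "\<not> adj s p" "t \<in> V - {p, q}" "\<not> adj t q" by blast
    \<comment> \<open>The only class with two vertices is dissolved into the singleton classes of
      \<open>s\<close> and \<open>t\<close>. These differ, as \<open>s\<close> misses
      \<open>p\<close> and so must be adjacent to \<open>q\<close>.\<close>
    define g where "g = f(p := f s, q := f t)"
    have "g u \<noteq> g v" if "adj u v" for u v
    proof -
      have "f s \<noteq> f t" using Qpq[OF st(1)] st single[OF st(1), of t] by auto
      then show ?thesis
        using that st npq single[OF st(1)] single[OF st(3)] adj_V[OF that] opt_proper[OF f that] adj_sym
        unfolding g_def by (smt (verit, best) fun_upd_apply)
    qed
    then have "proper_coloring G g" by (simp add: proper_iff)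
    moreover have "g ` V \<subseteq> f ` V - {f p}"
    proof
      fix i assume "i \<in> g ` V"
      then obtain v where v: "v \<in> V" "i = g v" by blast
      have "f v \<noteq> f p" if "v \<in> V - {p, q}" for v using single[OF that, of p] pq that by auto
      then show "i \<in> f ` V - {f p}" using v st unfolding g_def by auto
    qed
    ultimately show False using fewer_colors_False[OF f] pq by blast
  qed
  then show ?thesis
  proof
    assume p: "\<forall>s\<in>V - {p, q}. adj s p"
    have "adj s t" if "s \<in> V" "t \<in> V" "s \<noteq> t" "s \<noteq> q" "t \<noteq> q" for s t
      using that p Q[of s t] adj_sym by (cases "s = p"; cases "t = p") auto
    then show ?thesis using complete_minus_vertex_listed[OF k n f pq] by blast
  next
    assume p: "\<forall>s\<in>V - {p, q}. adj s q"
    have "adj s t" if "s \<in> V" "t \<in> V" "s \<noteq> t" "s \<noteq> p" "t \<noteq> p" for s t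
      using that p Q[of s t] adj_sym by (cases "s = q"; cases "t = q") auto
    then show ?thesis
      using complete_minus_vertex_listed[OF k n f pq(2,1) pq(3)[symmetric] pq(4)[symmetric]] by blast
  qed
qed

end

section \<open>All classes of size at most two\<close>

locale small_classes = villainy_two +
  assumes k3: "3 \<le> k"
    and no3: "\<And>f a b c. opt f \<Longrightarrow> {a, b, c} \<subseteq> V \<Longrightarrow> distinct [a, b, c] \<Longrightarrow> f a = f b \<Longrightarrow> f b = f c \<Longrightarrow> False"
begin

text \<open>The form in which the size bound is used below: exhibiting a proper coloring from a
  palette of at most \<open>k\<close> colors with three equal vertices is enough for a
  contradiction.\<close>

lemma proper_few_colors_no_three:
  assumes "\<And>u v. adj u v \<Longrightarrow> g u \<noteq> (g v :: nat)" "g ` V \<subseteq> C" "finite C" "card C \<le> k"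
    and "{a, b, c} \<subseteq> V" "distinct [a, b, c]" "g a = g b" "g b = g c"
  shows False
proof -
  have "card (g ` V) \<le> card C" using assms(2,3) by (rule card_mono[rotated])
  then have "opt g" using assms(1,4) by (simp add: opt_def proper_iff)
  then show False using no3[of g a b c] assms(5-) by blast
qed

lemma class_le_2:
  assumes "opt f" "A \<subseteq> V"
  shows "card {v \<in> A. f v = i} \<le> 2"
proof (rule ccontr)
  assume "\<not> ?thesis"
  then obtain a b c where "{a, b, c} \<subseteq> {v \<in> A. f v = i}" "distinct [a, b, c]"
    using three_of_card[of "{v \<in> A. f v = i}"] by auto
  then show False using no3[OF assms(1), of a b c] assms(2) by auto
qed

lemma two_disjoint_pairs:
  assumes f: "opt f" and n: "k + 2 \<le> card V"
  obtains y y' z z' where "{y, y', z, z'} \<subseteq> V" "y \<noteq> y'" "z \<noteq> z'" "f y = f y'" "f z = f z'" "f y \<noteq> f z"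
proof -
  obtain y y' where y: "y \<in> V" "y' \<in> V" "y \<noteq> y'" "f y = f y'"
    using pigeonhole_pair[OF f order_refl] n by auto
  have "k < card (V - {y})" using n y by simp
  then obtain z z' where z: "z \<in> V - {y}" "z' \<in> V - {y}" "z \<noteq> z'" "f z = f z'"
    using pigeonhole_pair[OF f, of "V - {y}"] by auto
  have "f y \<noteq> f z" using no3[OF f, of y z z'] y z by auto
  then show thesis using that[of y y' z z'] y z by auto
qed

lemma two_pairs_listed:
  assumes n: "card V = k + 2"
  shows "listed G"
proof -
  obtain f where f: "opt f" using opt_exists by blast
  obtain y y' z z' where p: "{y, y', z, z'} \<subseteq> V" "y \<noteq> y'" "z \<noteq> z'" "f y = f y'" "f z = f z'" "f y \<noteq> f z"
    by (rule two_disjoint_pairs[OF f]) (use n in auto)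
  have cross: "\<not> adj a b \<and> \<not> adj a' b' \<or> \<not> adj a b' \<and> \<not> adj a' b"
    if "adj a a'" "adj b b'" "distinct [a, a', b, b']" for a a' b b'
    using two_pairs[OF f p that] .
  show ?thesis
  proof (cases triangle_free)
    case False
    then obtain a b c where T: "adj a b" "adj b c" "adj c a" unfolding triangle_free_def by blast
    have abc: "distinct [a, b, c]" "{a, b, c} \<subseteq> V" using T adj_V by auto
    \<comment> \<open>An edge leaving the triangle and the opposite triangle edge violate
      \<open>cross\<close>: one triangle edge occurs in each alternative.\<close>
    have far: "\<not> adj d a \<and> \<not> adj d b \<and> \<not> adj d c" if "d \<notin> {a, b, c}" for d
      using cross[of a d b c] cross[of b d a c] cross[of c d a b] T abc that adj_sym by auto
    have far': "\<not> adj a d \<and> \<not> adj b d \<and> \<not> adj c d" if "d \<notin> {a, b, c}" for d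
      using far[OF that] adj_sym by blast
    have cardD: "card (V - {a, b, c}) = k - 1" using n abc by (simp add: card_Diff_subset)
    \<comment> \<open>The \<open>k - 1\<close> vertices off the triangle can get distinct colors,
      and for \<open>k - 1 \<ge> 3\<close> the triangle reuses three of these; one color would be
      saved.\<close>
    have "k = 3"
    proof (rule ccontr)
      assume "k \<noteq> 3"
      then have k4: "3 \<le> k - 1" using k3 by simp
      have "finite (V - {a, b, c})" by simp
      then obtain h where h: "bij_betw h (V - {a, b, c}) {0..<k - 1}"
        using ex_bij_betw_finite_nat cardD by metis
      define g where "g v = (if v = a then 0 else if v = b then 1 else if v = c then 2 else h v)" for v
      have "g u \<noteq> g v" if uv: "adj u v" for u v
      proof (cases "u \<in> {a, b, c}")
        case True
        then have "v \<in> {a, b, c}" using far uv adj_sym by blast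
        then show ?thesis using True abc adj_V(3)[OF uv] by (auto simp: g_def)
      next
        case False
        then have v: "v \<notin> {a, b, c}" using far uv by blast
        then have "h u \<noteq> h v"
          using False h adj_V[OF uv] unfolding bij_betw_def inj_on_def by blast
        then show ?thesis using False v by (simp add: g_def)
      qed
      then have "k \<le> card (g ` V)" using chromatic_number_le by (simp add: proper_iff)
      moreover have "h v < k - 1" if "v \<in> V - {a, b, c}" for v
        using h that by (auto simp: bij_betw_def)
      then have "g ` V \<subseteq> {..<k - 1}" using k4 by (auto simp: g_def)
      then have "card (g ` V) \<le> card {..<k - 1}" by (intro card_mono) auto
      ultimately show False using k3 by simp
    qed
    then obtain d e where de: "V - {a, b, c} = {d, e}" "d \<noteq> e" using cardD card_2_obtain by auto
    have V: "V = {a, b, c, d, e}" using de abc by auto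
    have d5: "distinct [a, b, c, d, e]" using de abc by auto
    have "adj d e"
    proof (rule ccontr)
      assume nde: "\<not> adj d e"
      define g where "g v = (if v = b then 1 else if v = c then 2 else 0 :: nat)" for v
      have "g u \<noteq> g v" if uv: "adj u v" for u v
        using adj_V[OF uv] uv nde far[of d] far[of e] adj_sym d5 unfolding V g_def by auto
      moreover have "g ` V \<subseteq> {0, 1, 2}" by (auto simp: g_def)
      moreover have "g a = g d" "g d = g e" using d5 by (auto simp: g_def)
      ultimately show False
        using proper_few_colors_no_three[of g "{0, 1, 2}" a d e] V d5 k3 by auto
    qed
    have "G \<simeq> complete_graph 3 \<uplus> complete_graph 2"
      by (rule iso_listI[where xs = "[a, b, c, d, e]" and ys = "[Inl 0, Inl 1, Inl 2, Inr 0, Inr 1]"])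
        (use V d5 T adj_sym[of c a] far'[of d] far'[of e] \<open>adj d e\<close> in \<open>auto simp: standard_graphs\<close>)
    then show ?thesis by (simp add: listed_def)
  next
    case tf: True
    have "k = 3"
    proof (rule ccontr)
      assume "k \<noteq> 3"
      then have k4: "4 \<le> k" using k3 by simp
      \<comment> \<open>Dropping one vertex from each pair leaves one vertex per color. For
        \<open>k \<ge> 4\<close> this yields two singleton classes, too many for a triangle-free
        graph.\<close>
      have "f ` (V - {y, z}) = f ` V"
        using p by (auto simp: image_iff) (metis Diff_iff empty_iff insert_iff)+
      moreover have yz: "y \<noteq> z" using p by auto
      moreover have cyz: "card (V - {y, z}) = k" using n p yz by (simp add: card_Diff_subset)
      ultimately have inj: "inj_on f (V - {y, z})"
        using opt_card[OF f] by (intro eq_card_imp_inj_on) auto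
      have y': "y' \<in> V - {y, z}" "z' \<in> V - {y, z}" using p by auto
      have "y' \<noteq> z'" using p by auto
      then have "card (V - {y, z} - {y', z'}) = k - 2" using cyz y' by (simp add: card_Diff_subset)
      then have "2 \<le> card (V - {y, z} - {y', z'})" using k4 by simp
      then obtain s t where st: "{s, t} \<subseteq> V - {y, z} - {y', z'}" "s \<noteq> t"
        by (rule two_of_card)
      have single: "v = s" if "s \<in> V - {y, z} - {y', z'}" "v \<in> V" "f v = f s" for s v
        using inj_onD[OF inj, of v s] inj_onD[OF inj, of y' s] inj_onD[OF inj, of z' s] that p y'
        by (cases "v = y"; cases "v = z") auto
      have s: "s \<in> V - {y, z} - {y', z'}" and t: "t \<in> V - {y, z} - {y', z'}" using st by auto
      have "s \<in> V" "t \<in> V" using s t by auto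
      then have "s = t" using triangle_free_one_singleton[OF tf f k3 _ single[OF s] _ single[OF t]] by blast
      then show False using st by simp
    qed
    then have n5: "card V = 5" using n by simp
    then obtain a b c d e where C: "adj a b" "adj b c" "adj c d" "adj d e" "adj e a"
      using five_cycle_or_three_matching[OF tf k3] by auto
    note D = triangle_free_5_cycle_distinct[OF tf C]
    have "set [a, b, c, d, e] = V"
      using adj_V[OF C(1)] adj_V[OF C(2)] adj_V[OF C(3)] adj_V[OF C(4)] n5 D(1) distinct_card[OF D(1)]
      by (intro card_subset_eq) auto
    then have "G \<simeq> cycle_graph 5"
      by (intro iso_listI[where xs = "[a, b, c, d, e]" and ys = "[0, 1, 2, 3, 4]"])
        (use C D adj_sym[of a e] in \<open>auto simp: standard_graphs\<close>)
    then show ?thesis by (simp add: listed_def)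
  qed
qed

lemma no_three_matching:
  assumes n: "k + 3 \<le> card V"
    and m: "adj a a'" "adj b b'" "adj c c'" "distinct [a, a', b, b', c, c']"
  shows False
proof -
  obtain f where f: "opt f" using opt_exists by blast
  obtain y y' z z' where p: "{y, y', z, z'} \<subseteq> V" "y \<noteq> y'" "z \<noteq> z'" "f y = f y'" "f z = f z'" "f y \<noteq> f z"
    by (rule two_disjoint_pairs[OF f]) (use n in auto)
  have "y \<noteq> z" using p by auto
  then have "k < card (V - {y, z})" using n p by (simp add: card_Diff_subset)
  then obtain w w' where w: "w \<in> V - {y, z}" "w' \<in> V - {y, z}" "w \<noteq> w'" "f w = f w'"
    using pigeonhole_pair[OF f, of "V - {y, z}"] by auto
  have "f y \<noteq> f w" using no3[OF f, of y w w'] p w by auto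
  moreover have "f z \<noteq> f w" using no3[OF f, of z w w'] p w by auto
  ultimately show False using three_pairs[OF f _ p(2,3) w(3) p(4,5) w(4) p(6) _ _ m] p w by auto
qed

lemma three_pairs_listed:
  assumes n: "k + 3 \<le> card V" and k: "k = 3"
  shows "listed G"
proof -
  note nom = no_three_matching[OF n]
  obtain f where f: "opt f" using opt_exists by blast
  have "card V \<le> card (f ` V) * 2"
    using class_le_2[OF f] by (intro card_le_fibres) auto
  then have n6: "card V = 6" using opt_card[OF f] n k by simp
  show ?thesis
  proof (cases triangle_free)
    case tf: True
    obtain a b c d e where C: "adj a b" "adj b c" "adj c d" "adj d e" "adj e a"
      using five_cycle_or_three_matching[OF tf k3] n6 by auto
    note D = triangle_free_5_cycle_distinct[OF tf C]
    have sub: "{a, b, c, d, e} \<subseteq> V" using adj_V[OF C(1)] adj_V[OF C(2)] adj_V[OF C(3)] adj_V[OF C(4)] by auto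
    have "card (V - {a, b, c, d, e}) = 1"
      using n6 sub distinct_card[OF D(1)] by (simp add: card_Diff_subset)
    then obtain w where w: "V - {a, b, c, d, e} = {w}" by (rule card_1_singletonE)
    have V: "V = {a, b, c, d, e, w}" using w sub by blast
    have wn: "w \<notin> {a, b, c, d, e}" using w by blast
    have iso: "\<not> adj w a" "\<not> adj w b" "\<not> adj w c" "\<not> adj w d" "\<not> adj w e"
      using nom[of w a b c d e] nom[of w b c d e a] nom[of w c d e a b] nom[of w d e a b c] nom[of w e a b c d]
        C D(1) wn by auto
    \<comment> \<open>An edge from \<open>w\<close> to the 5-cycle would complete two cycle edges to
      a three-edge matching, so \<open>w\<close> is isolated and can join the class of
      \<open>a\<close> and \<open>c\<close>.\<close>
    define g where "g v = (if v = b \<or> v = d then 1 else if v = e then 2 else 0 :: nat)" for v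
    have nadj: "\<not> adj x y" if "x \<in> {a, c, w}" "y \<in> {a, c, w}" for x y
      using that iso D(2) adj_sym by auto
    have gp: "g u \<noteq> g v" if uv: "adj u v" for u v
    proof -
      have "u \<in> {a, c, w} \<or> u \<in> {b, d} \<or> u = e" "v \<in> {a, c, w} \<or> v \<in> {b, d} \<or> v = e"
        using adj_V[OF uv] V by auto
      then show ?thesis
        using nadj[of u v] uv D adj_sym adj_V(3)[OF uv] wn unfolding g_def by auto
    qed
    have gi: "g ` V \<subseteq> {0, 1, 2}" by (auto simp: g_def)
    have gs: "g a = g c" "g c = g w" using D(1) wn by (auto simp: g_def)
    have False
      by (rule proper_few_colors_no_three[OF gp gi _ _ _ _ gs]) (use V D(1) wn k3 in auto)
    then show ?thesis ..
  next
    case False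
    then obtain a b c where T: "adj a b" "adj b c" "adj c a" unfolding triangle_free_def by blast
    have abc: "{a, b, c} \<subseteq> V" using T adj_V by auto
    have partner: "\<exists>y\<in>V. y \<noteq> x \<and> f y = f x" if x: "x \<in> V" for x
    proof (rule ccontr)
      assume s: "\<not> ?thesis"
      have "f ` (V - {x}) \<subseteq> f ` V - {f x}" using s x by auto
      then have "card (f ` (V - {x})) \<le> card (f ` V - {f x})" by (intro card_mono) auto
      then have "card (f ` (V - {x})) \<le> 2" using x opt_card[OF f] k by simp
      moreover have "card (V - {x}) \<le> card (f ` (V - {x})) * 2"
        by (intro card_le_fibres class_le_2[OF f]) auto
      ultimately show False using n6 x by simp
    qed
    \<comment> \<open>Otherwise \<open>x\<close> could join the class \<open>{y, y'}\<close> and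
      make it a class of three.\<close>
    have either: "adj x y \<or> adj x y'"
      if xy: "{x, y, y'} \<subseteq> V" "y \<noteq> y'" "f y = f y'" "f x \<noteq> f y" for x y y'
    proof (rule ccontr)
      assume nx: "\<not> ?thesis"
      have nadj: "\<not> adj x v" if v: "f v = f y" for v
      proof
        assume "adj x v"
        then have "v \<in> V" "v \<noteq> y" "v \<noteq> y'" using nx adj_V by blast+
        then have "{y, y', v} \<subseteq> V" "distinct [y, y', v]" using xy by auto
        then show False using no3[OF f] xy(3) v by metis
      qed
      have o: "opt (f(x := f y))" using xy by (intro move_opt[OF f _ nadj]) auto
      have "x \<noteq> y" "x \<noteq> y'" using xy by auto
      then show False using xy by (intro no3[OF o, of x y y']) auto
    qed
    obtain d e h where deh: "d \<in> V" "d \<noteq> a" "f d = f a" "e \<in> V" "e \<noteq> b" "f e = f b" "h \<in> V" "h \<noteq> c" "f h = f c"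
      using partner abc by (metis insert_subset)
    have fd: "f a \<noteq> f b" "f b \<noteq> f c" "f a \<noteq> f c" using T opt_proper[OF f] by metis+
    have d6: "distinct [a, b, c, d, e, h]" using deh fd T adj_V(3) by auto
    have "set [a, b, c, d, e, h] = V"
      using abc deh n6 distinct_card[OF d6] by (intro card_subset_eq) auto
    then have V: "V = {a, b, c, d, e, h}" by simp
    have non: "\<not> adj a d" "\<not> adj b e" "\<not> adj c h" using deh opt_proper[OF f] by metis+
    have ei: "adj b d \<or> adj d e" "adj c d \<or> adj d h" "adj a e \<or> adj d e" "adj c e \<or> adj e h"
      "adj a h \<or> adj d h" "adj b h \<or> adj e h"
      using either[of d b e] either[of d c h] either[of e a d] either[of e c h] either[of h a d] either[of h b e]
        deh fd abc by (auto simp: adj_sym)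
    have pm: "distinct [a, b, c, d, e, h]" "distinct [a, b, c, e, d, h]" "distinct [b, c, a, e, d, h]"
      "distinct [b, c, a, h, d, e]" "distinct [c, a, b, d, e, h]" "distinct [c, a, b, h, d, e]"
      "distinct [a, e, b, h, c, d]" "distinct [a, h, b, d, c, e]"
      using d6 by auto
    have nm: "\<not> (adj a b \<and> adj c d \<and> adj e h)" "\<not> (adj a b \<and> adj c e \<and> adj d h)"
      "\<not> (adj b c \<and> adj a e \<and> adj d h)" "\<not> (adj b c \<and> adj a h \<and> adj d e)"
      "\<not> (adj c a \<and> adj b d \<and> adj e h)" "\<not> (adj c a \<and> adj b h \<and> adj d e)"
      "\<not> (adj a e \<and> adj b h \<and> adj c d)" "\<not> (adj a h \<and> adj b d \<and> adj c e)"
      using nom[OF _ _ _ pm(1)] nom[OF _ _ _ pm(2)] nom[OF _ _ _ pm(3)] nom[OF _ _ _ pm(4)] nom[OF _ _ _ pm(5)] nom[OF _ _ _ pm(6)] nom[OF _ _ _ pm(7)] nom[OF _ _ _ pm(8)] by blast+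
    \<comment> \<open>Without \<open>d e\<close>, the facts \<open>ei\<close> and \<open>nm\<close>
      force all six cross edges in turn, and these contain a three-edge matching. With
      \<open>d e\<close>, the two cross edges at \<open>h\<close> are excluded, so
      \<open>d h\<close> and \<open>e h\<close> follow, and then the other cross edges fail.\<close>
    have cl: "adj d e" "adj d h" "adj e h" "\<not> adj a e" "\<not> adj a h" "\<not> adj b d" "\<not> adj b h" "\<not> adj c d" "\<not> adj c e"
      using ei nm T by blast+
    have "G \<simeq> complete_graph 3 \<uplus> complete_graph 3"
      by (rule iso_listI[where xs = "[a, b, c, d, e, h]" and ys = "[Inl 0, Inl 1, Inl 2, Inr 0, Inr 1, Inr 2]"])
        (use V d6 T adj_sym[of c a] cl non in \<open>auto simp: standard_graphs\<close>)
    then show ?thesis by (simp add: listed_def)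
  qed
qed

lemma three_pairs_four_colors_False:
  assumes n: "k + 3 \<le> card V" and k4: "4 \<le> k"
  shows False
proof -
  note nom = no_three_matching[OF n]
  obtain f where f: "opt f" using opt_exists by blast
  have "4 \<le> card (f ` V)" using opt_card[OF f] k4 by simp
  then obtain i1 i2 i3 i4 where i: "{i1, i2, i3, i4} \<subseteq> f ` V" "distinct [i1, i2, i3, i4]"
    using four_of_card by metis
  then obtain v1 v2 v3 v4 where v: "{v1, v2, v3, v4} \<subseteq> V" "i1 = f v1" "i2 = f v2" "i3 = f v3" "i4 = f v4"
    by auto
  obtain a b where ab: "f a = i1" "f b = i2" "adj a b"
    using classes_adjacent[OF f, of v1 v2] v i by auto
  obtain c d where cd: "f c = i3" "f d = i4" "adj c d"
    using classes_adjacent[OF f, of v3 v4] v i by auto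
  let ?K = "{a, b, c, d}"
  have KV: "?K \<subseteq> V" using adj_V[OF ab(3)] adj_V[OF cd(3)] by auto
  have fK: "inj_on f ?K" using ab cd i by auto
  have dist: "distinct [a, b, c, d]" using ab cd i by auto
  define I where "I = V - ?K"
  have "card I + 4 = card V" using KV dist n k4 unfolding I_def by (simp add: card_Diff_subset)
  then have "3 \<le> card I" using n k4 by simp
  then obtain x1 x2 x3 where x: "{x1, x2, x3} \<subseteq> I" "distinct [x1, x2, x3]" using three_of_card by blast
  \<comment> \<open>An edge within \<open>I\<close> would form a three-edge matching with
    \<open>a b\<close> and \<open>c d\<close>.\<close>
  have indI: "\<not> adj u w" if "u \<in> I" "w \<in> I" for u w
    using nom[of a b c d u w] ab cd dist that adj_V(3)[of u w] unfolding I_def by auto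
  obtain N where N: "N \<notin> f ` V" using ex_new_if_finite[of "f ` V"] infinite_UNIV_nat by auto
  \<comment> \<open>No colouring with few colours may use one colour for all of \<open>I\<close>.\<close>
  have key: False if "S \<subseteq> V" "I \<subseteq> S" "\<And>u w. u \<in> S \<Longrightarrow> w \<in> S \<Longrightarrow> \<not> adj u w"
    and h: "\<And>u w. u \<in> ?K - S \<Longrightarrow> w \<in> ?K - S \<Longrightarrow> adj u w \<Longrightarrow> h u \<noteq> h w"
    and hc: "h ` (?K - S) \<subseteq> C" "C \<subseteq> f ` V" "card C < k" for S h C
  proof -
    define g where "g v = (if v \<in> S then N else h v)" for v
    have VS: "V - S \<subseteq> ?K - S" using that(2) unfolding I_def by auto
    have hN: "h v \<noteq> N" if "v \<in> V - S" for v
      using that VS hc N by (metis image_eqI subsetD)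
    have "g u \<noteq> g w" if uw: "adj u w" for u w
    proof (cases "u \<in> S"; cases "w \<in> S")
      assume "u \<in> S" "w \<in> S" then show ?thesis using \<open>\<And>u w. u \<in> S \<Longrightarrow> w \<in> S \<Longrightarrow> \<not> adj u w\<close> uw by blast
    next
      assume "u \<in> S" "w \<notin> S" then show ?thesis using hN[of w] adj_V[OF uw] by (auto simp: g_def)
    next
      assume "u \<notin> S" "w \<in> S" then show ?thesis using hN[of u] adj_V[OF uw] by (auto simp: g_def)
    next
      assume "u \<notin> S" "w \<notin> S"
      then show ?thesis using h[of u w] VS adj_V[OF uw] uw by (auto simp: g_def)
    qed
    moreover have "g ` V \<subseteq> insert N C" using VS hc(1) by (auto simp: g_def)
    moreover have "finite C" using hc(2) by (rule finite_subset) simp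
    moreover then have "card (insert N C) \<le> k" using hc by (simp add: card_insert_if)
    moreover have "g x1 = g x2" "g x2 = g x3" using x that(2) by (auto simp: g_def)
    ultimately show False
      using proper_few_colors_no_three[of g "insert N C" x1 x2 x3] x unfolding I_def by auto
  qed
  have IV: "I \<subseteq> V" and KI: "?K - I = ?K" by (auto simp: I_def)
  have k_eq: "k = 4"
  proof (rule ccontr)
    assume "k \<noteq> 4"
    then have "card (f ` ?K) < k" using k4 card_image[OF fK] dist by simp
    then show False
      using key[OF IV order_refl indI, of f "f ` ?K"] KV opt_proper[OF f] by (auto simp: image_mono)
  qed
  \<comment> \<open>Giving nonadjacent \<open>u\<close> and \<open>w\<close> one color leaves three
    colors on \<open>?K\<close>, hence a fourth for all of \<open>I\<close>.\<close>
  have K4: "adj u w" if "u \<in> ?K" "w \<in> ?K" "u \<noteq> w" for u w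
  proof (rule ccontr)
    assume nuw: "\<not> adj u w"
    let ?h = "f(u := f w)"
    have fu: "f u \<in> f ` ?K" using that by blast
    have "?h v \<noteq> ?h v'" if "v \<in> ?K" "v' \<in> ?K" "adj v v'" for v v'
      using that nuw fK \<open>u \<in> ?K\<close> \<open>w \<in> ?K\<close> adj_sym adj_V(3)[OF that(3)] unfolding inj_on_def
      by (metis fun_upd_apply)
    moreover have "?h ` ?K \<subseteq> f ` ?K - {f u}"
      using that fK unfolding inj_on_def by (auto simp del: insert_iff)
    moreover have "card (f ` ?K - {f u}) < k"
      using k_eq card_image[OF fK] dist fu by simp
    moreover have "f ` ?K - {f u} \<subseteq> f ` V" using KV by blast
    ultimately show False
      using key[OF IV order_refl indI, of ?h "f ` ?K - {f u}"] unfolding KI by blast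
  qed
  have nbr: "\<exists>i\<in>I. adj i w" if w: "w \<in> ?K" for w
  proof (rule ccontr)
    assume nw: "\<not> ?thesis"
    have "f w \<in> f ` ?K" using w by blast
    then have c: "card (f ` ?K - {f w}) < k" using k_eq card_image[OF fK] dist by simp
    have S: "\<not> adj u v" if "u \<in> insert w I" "v \<in> insert w I" for u v
      using that nw indI adj_sym by auto
    have h: "f ` (?K - insert w I) \<subseteq> f ` ?K - {f w}"
      using fK w unfolding inj_on_def by (auto simp del: insert_iff)
    have fV: "f ` ?K - {f w} \<subseteq> f ` V" using KV by blast
    have wI: "insert w I \<subseteq> V" using IV KV w by blast
    show False
      by (rule key[OF wI subset_insertI S _ h fV c]) (assumption | erule opt_proper[OF f])+
  qed
  obtain ia ib ic id where ii: "ia \<in> I" "adj ia a" "ib \<in> I" "adj ib b" "ic \<in> I" "adj ic c" "id \<in> I" "adj id d"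
    using nbr[of a] nbr[of b] nbr[of c] nbr[of d] by blast
  have nI: "i \<notin> ?K" if "i \<in> I" for i using that by (simp add: I_def)
  \<comment> \<open>Two different neighbors in \<open>I\<close> of two vertices of
    \<open>?K\<close>, together with the edge between the other two, would give a three-edge
    matching. So one vertex of \<open>I\<close> is adjacent to all of \<open>?K\<close>, and five
    mutually adjacent vertices contradict \<open>k = 4\<close>.\<close>
  have "ib = ia" using nom[of ia a ib b c d] ii cd dist nI[of ia] nI[of ib] by auto
  moreover have "ic = ia" using nom[of ia a ic c b d] K4[of b d] ii dist nI[of ia] nI[of ic] by auto
  moreover have "id = ia" using nom[of ia a id d b c] K4[of b c] ii dist nI[of ia] nI[of id] by auto
  ultimately have all: "adj ia a" "adj ia b" "adj ia c" "adj ia d" using ii by auto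
  have "f ia \<notin> f ` ?K" using opt_proper[OF f all(1)] opt_proper[OF f all(2)] opt_proper[OF f all(3)]
      opt_proper[OF f all(4)] by auto
  then have "card (f ` insert ia ?K) = 5" using card_image[OF fK] dist by (simp add: card_insert_if)
  moreover have "card (f ` insert ia ?K) \<le> card (f ` V)"
    using KV ii IV by (intro card_mono image_mono) auto
  ultimately show False using opt_card[OF f] k_eq by simp
qed

end

section \<open>Assembling the cases by number of colors, class sizes and surplus vertices\<close>

context villainy_two
begin

lemma villainy_two_listed: "listed G"
proof -
  have k2: "2 \<le> k" using some_edge k_ge_2 by blast
  consider "k = 2" | "\<exists>f i. opt f \<and> 4 \<le> card {v \<in> V. f v = i}"
    | "k \<noteq> 2" "\<forall>f i. opt f \<longrightarrow> \<not> 4 \<le> card {v \<in> V. f v = i}"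
    by blast
  then show ?thesis
  proof cases
    case 1 then show ?thesis by (rule two_colorable_listed)
  next
    case 2 then show ?thesis using class_of_four_listed by blast
  next
    case 3
    then have k3': "3 \<le> k" using k2 by simp
    have le3: "card {v \<in> V. f v = i} \<le> 3" if "opt f" for f i
      using 3(2)[rule_format, OF that, of i] by simp
    interpret small_classes G
      using k3' no_class_of_three[OF k3' _ le3] by unfold_locales blast+
    obtain f where f: "opt f" using opt_exists by blast
    have "k \<le> card V" using opt_card[OF f] card_image_le[OF finite_V, of f] by simp
    then consider "card V = k" | "card V = k + 1" | "card V = k + 2" | "k + 3 \<le> card V" by linarith
    then show ?thesis
    proof cases
      case 1
      \<comment> \<open>With as many vertices as colors all classes are singletons, hence pairwise
        adjacent, and the graph would be complete.\<close>
      then have inj: "inj_on f V" using opt_card[OF f] by (intro eq_card_imp_inj_on) auto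
      have "adj x y" if "x \<in> V" "y \<in> V" "x \<noteq> y" for x y
        using singleton_class_adjacent[OF f, of x y] that inj_onD[OF inj] adj_V by metis
      then show ?thesis using not_complete by blast
    next
      case 2 then show ?thesis using one_pair_listed k3 by blast
    next
      case 3 then show ?thesis by (rule two_pairs_listed)
    next
      case 4 then show ?thesis
        using three_pairs_listed three_pairs_four_colors_False k3 by (cases "k = 3") auto
    qed
  qed
qed

end

theorem theorem2:
  fixes G :: "'a sgraph"
  assumes "simple_graph G"
    and "villainy G = 2"
  shows "(\<exists>t\<ge>2. G \<simeq> complete_bipartite_graph 1 t)
    \<or> (card (verts G) = 6 \<and> connected_graph G \<and>
        (\<exists>X Y. bipartition G X Y \<and> card X = 3 \<and> card Y = 3))
    \<or> (G \<simeq> path_graph 4 \<or> G \<simeq> path_graph 4 \<uplus> complete_graph 1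
        \<or> G \<simeq> path_graph 4 \<uplus> complete_graph 2)
    \<or> (G \<simeq> cycle_graph 4 \<or> G \<simeq> cycle_graph 4 \<uplus> complete_graph 1
        \<or> G \<simeq> cycle_graph 4 \<uplus> complete_graph 2)
    \<or> G \<simeq> cycle_graph 5
    \<or> (G \<simeq> complete_graph 2 \<uplus> complete_graph 2
        \<or> G \<simeq> complete_graph 2 \<uplus> complete_graph 2 \<uplus> complete_graph 2)
    \<or> G \<simeq> complete_graph 3 \<uplus> complete_graph 2
    \<or> G \<simeq> complete_graph 3 \<uplus> complete_graph 3
    \<or> G \<simeq> complete_graph 2 \<uplus> complete_graph 2 \<uplus> complete_graph 1
    \<or> (card (verts G) \<ge> 4 \<and>
        (\<exists>v\<in>verts G. (degree G v = 0 \<or> degree G v = 1) \<and> is_complete (delete_vertex G v)))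
    \<or> (\<exists>r\<ge>1. G \<simeq> path_graph 3 \<uplus> empty_graph r)
    \<or> (\<exists>r\<ge>1. G \<simeq> complete_graph 2 \<uplus> empty_graph r)"
proof -
  interpret villainy_two G
    using assms by unfold_locales
  show ?thesis using villainy_two_listed unfolding listed_def .
qed

end
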